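(* Every triangle $ABC$ is equal (in the sense of equal triangles) to each of the triangles $BCA$, $CAB$, $ACB$, $BAC$, and $CBA$.
   Context: Setting: elementary (synthetic) Euclidean plane geometry, as axiomatized for example by Hilbert or Tarski, with the Euclidean parallel postulate and line-circle continuity; Archimedes' axiom is not assumed. $\mathbf{B}(X,Y,Z)$ means $Y$ lies strictly between $X$ and $Z$. For segments, "$=$" means congruence. A rectangle is given by an ordered list $PQRS$ of its vertices going around it; its base (width) is $PQ$ and its height is $QR$. Rectangles $PQRS$ and $pqrs$ are congruent if $PQ=pq$ and $QR=qr$. Equal rectangles: given rectangles $R$ and $S$, place congruent copies of them as $FEBG$ (congruent to $R$) and $BMLA$ (congruent to $S$) with $\mathbf{B}(A,B,E)$ and $\mathbf{B}(G,B,M)$, and let $H,K$ be the points such that $ABGH$ and $BMKE$ are rectangles. Then $R$ and $S$ are equal rectangles if and only if $\mathbf{B}(H,B,K)$. A triangle is an ordered triple of non-collinear points; the base of triangle $ABC$ is $AB$. The first circumscribed rectangle of triangle $ABC$ is the rectangle $ABDK$ such that $C$ lies on the line through $D$ and $K$ (the triangle need not lie inside the rectangle). Two triangles are equal triangles if their first circumscribed rectangles are equal rectangles. *)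

theory Defs
  imports Main
begin

text \<open>
  Tarski's axioms for elementary plane geometry: \<open>bet\<close> is non-strict betweenness and
  \<open>seg_cong A B C D\<close> is congruence of the segments \<open>AB\<close> and \<open>CD\<close>. There is no continuity
  schema and no Archimedean axiom; the only continuity assumption is \<open>line_circle\<close>: a line
  through a point \<open>p\<close> strictly inside the circle with centre \<open>a\<close> through \<open>b\<close> meets this
  circle on both sides of \<open>p\<close>. The three disjuncts in \<open>upper_dim\<close> and \<open>line_circle\<close> spell
  out collinearity.
\<close>

class euclidean_plane =
  fixes bet :: "'a \<Rightarrow> 'a \<Rightarrow> 'a \<Rightarrow> bool"
    and seg_cong :: "'a \<Rightarrow> 'a \<Rightarrow> 'a \<Rightarrow> 'a \<Rightarrow> bool"
  assumes cong_pseudo_refl: "seg_cong a b b a"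
    and cong_inner_trans: "seg_cong a b p q \<Longrightarrow> seg_cong a b r s \<Longrightarrow> seg_cong p q r s"
    and cong_identity: "seg_cong a b c c \<Longrightarrow> a = b"
    and segment_construction: "\<exists>x. bet q a x \<and> seg_cong a x b c"
    and five_segment:
      "a \<noteq> b \<Longrightarrow> bet a b c \<Longrightarrow> bet a' b' c' \<Longrightarrow>
       seg_cong a b a' b' \<Longrightarrow> seg_cong b c b' c' \<Longrightarrow>
       seg_cong a d a' d' \<Longrightarrow> seg_cong b d b' d' \<Longrightarrow> seg_cong c d c' d'"
    and bet_identity: "bet a b a \<Longrightarrow> a = b"
    and inner_pasch: "bet a p c \<Longrightarrow> bet b q c \<Longrightarrow> \<exists>x. bet p x b \<and> bet q x a"
    and lower_dim: "\<exists>a b c. \<not> bet a b c \<and> \<not> bet b c a \<and> \<not> bet c a b"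
    and upper_dim:
      "p \<noteq> q \<Longrightarrow> seg_cong a p a q \<Longrightarrow> seg_cong b p b q \<Longrightarrow> seg_cong c p c q \<Longrightarrow>
       bet a b c \<or> bet b c a \<or> bet c a b"
    and euclid:
      "bet a d t \<Longrightarrow> bet b d c \<Longrightarrow> a \<noteq> d \<Longrightarrow>
       \<exists>x y. bet a b x \<and> bet a c y \<and> bet x t y"
    and line_circle:
      "u \<noteq> v \<Longrightarrow> bet u v p \<or> bet v p u \<or> bet p u v \<Longrightarrow> bet a p b \<Longrightarrow> p \<noteq> b \<Longrightarrow>
       \<exists>x y. (bet u v x \<or> bet v x u \<or> bet x u v) \<and>
             (bet u v y \<or> bet v y u \<or> bet y u v) \<and>
             seg_cong a x a b \<and> seg_cong a y a b \<and> bet x p y"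
begin

definition sbet :: "'a \<Rightarrow> 'a \<Rightarrow> 'a \<Rightarrow> bool" where
  "sbet A B C \<longleftrightarrow> bet A B C \<and> A \<noteq> B \<and> B \<noteq> C"

definition col :: "'a \<Rightarrow> 'a \<Rightarrow> 'a \<Rightarrow> bool" where
  "col A B C \<longleftrightarrow> bet A B C \<or> bet B C A \<or> bet C A B"

text \<open>
  An angle \<open>ABC\<close> is right if it equals its supplement: doubling \<open>AB\<close> beyond \<open>B\<close> to \<open>X\<close>
  gives \<open>AC = XC\<close>. Both sides of the angle are non-degenerate.
\<close>

definition right_angle :: "'a \<Rightarrow> 'a \<Rightarrow> 'a \<Rightarrow> bool" where
  "right_angle A B C \<longleftrightarrow>
     B \<noteq> C \<and> (\<exists>X. sbet A B X \<and> seg_cong A B X B \<and> seg_cong A C X C)"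

text \<open>The base of the rectangle \<open>PQRS\<close> is \<open>PQ\<close> and its height is \<open>QR\<close>.\<close>

definition rectangle :: "'a \<Rightarrow> 'a \<Rightarrow> 'a \<Rightarrow> 'a \<Rightarrow> bool" where
  "rectangle P Q R S \<longleftrightarrow>
     right_angle P Q R \<and> right_angle Q R S \<and> right_angle R S P \<and> right_angle S P Q"

definition congruent_rectangles ::
  "'a \<times> 'a \<times> 'a \<times> 'a \<Rightarrow> 'a \<times> 'a \<times> 'a \<times> 'a \<Rightarrow> bool" where
  "congruent_rectangles = (\<lambda>(P, Q, R, S) (p, q, r, s).
     rectangle P Q R S \<and> rectangle p q r s \<and> seg_cong P Q p q \<and> seg_cong Q R q r)"

text \<open>
  The placement of the two copies is existentially quantified: one always exists, and any two
  are congruent, so the choice is immaterial.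
\<close>

definition equal_rectangles ::
  "'a \<times> 'a \<times> 'a \<times> 'a \<Rightarrow> 'a \<times> 'a \<times> 'a \<times> 'a \<Rightarrow> bool" where
  "equal_rectangles r s \<longleftrightarrow>
     (\<exists>A B E F G H K L M.
        congruent_rectangles r (F, E, B, G) \<and> congruent_rectangles s (B, M, L, A) \<and>
        sbet A B E \<and> sbet G B M \<and>
        rectangle A B G H \<and> rectangle B M K E \<and>
        sbet H B K)"

definition triangle :: "'a \<times> 'a \<times> 'a \<Rightarrow> bool" where
  "triangle = (\<lambda>(A, B, C). \<not> col A B C)"

definition first_circumscribed_rectangle ::
  "'a \<times> 'a \<times> 'a \<Rightarrow> 'a \<times> 'a \<times> 'a \<times> 'a \<Rightarrow> bool" where
  "first_circumscribed_rectangle = (\<lambda>(A, B, C) (P, Q, D, K).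
     P = A \<and> Q = B \<and> rectangle A B D K \<and> col D K C)"

text \<open>
  A triangle has exactly one first circumscribed rectangle, so the quantifiers over \<open>r\<close> and
  \<open>s\<close> amount to a definite description.
\<close>

definition equal_triangles :: "'a \<times> 'a \<times> 'a \<Rightarrow> 'a \<times> 'a \<times> 'a \<Rightarrow> bool" where
  "equal_triangles t u \<longleftrightarrow> triangle t \<and> triangle u \<and>
     (\<exists>r s. first_circumscribed_rectangle t r \<and> first_circumscribed_rectangle u s \<and>
            equal_rectangles r s)"

end

end

theory Submission
  imports Defs
begin

text \<open>
  Place the two rectangles of the definition with common corner \<open>B\<close>. If the first has base \<open>c\<close> and
  height \<open>q\<close>, the second base \<open>a\<close> and height \<open>p\<close>, then \<open>H\<close> and \<open>K\<close> lie in opposite quadrants at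
  \<open>B\<close>; the legs of \<open>H\<close> are \<open>c\<close> and \<open>p\<close>, those of \<open>K\<close> are \<open>a\<close> and \<open>q\<close>. So the rectangles are equal
  when \<open>p : c = q : a\<close>. For a triangle \<open>ABC\<close> let \<open>c = BA\<close>, \<open>a = BC\<close>, let \<open>q\<close> be the height of \<open>C\<close>
  over \<open>AB\<close> and \<open>p\<close> the height of \<open>A\<close> over \<open>CB\<close>: both ratios are the sine of the angle at \<open>B\<close>.
  What has to be proved is that right triangles which agree in the ratio of a leg to the hypotenuse
  yield legs in equal ratio, without a theory of proportion.

  The substitute for proportion is a scaling map. For a rotation \<open>f\<close> about \<open>B\<close> put
  \<open>\<kappa> v = mid (f v) (f\<inverse> v)\<close>, which multiplies by the cosine of the angle of rotation
  (\<open>scale\<close> below). Writing \<open>f\<close> as a product of two line reflections, the theorem of the three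
  reflections (\<open>three_reflections\<close>) shows that \<open>\<kappa>\<close> commutes with all reflections in lines through
  \<open>B\<close>. Hence \<open>\<kappa>\<close> keeps each of these lines, and the length of \<open>\<kappa> v\<close> depends only on the length of
  \<open>v\<close>. Orthogonal projection preserves midpoints (\<open>foot_mid\<close>, which rests on the parallel
  postulate), and it follows that \<open>\<kappa>\<close> commutes with the projections onto lines through \<open>B\<close>
  (\<open>foot_scale\<close>). By line-circle continuity every ratio that is at most \<open>1\<close> occurs (\<open>ex_scale\<close>).

  Now assume \<open>a \<le> c\<close> and choose \<open>\<kappa>\<close> such that \<open>\<kappa> A\<close> has distance \<open>a\<close> from \<open>B\<close>. Let \<open>D\<close> be the
  projection of \<open>C\<close> to the perpendicular of \<open>AB\<close> at \<open>B\<close>, and \<open>D'\<close> that of \<open>A\<close> to the perpendicular of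
  \<open>CB\<close> at \<open>B\<close>, so that \<open>q = BD\<close> and \<open>p = BD'\<close>. The reflection in the line through \<open>B\<close> that exchanges
  \<open>C\<close> and \<open>\<kappa> A\<close> exchanges the lines \<open>BC\<close> and \<open>BA\<close>, therefore also their perpendiculars at \<open>B\<close>, and
  maps \<open>D\<close> to the projection of \<open>\<kappa> A\<close>, which is \<open>\<kappa> D'\<close>. Thus \<open>\<kappa>\<close> takes \<open>c\<close> to \<open>a\<close> and \<open>p\<close> to \<open>q\<close>.
  Consequently the projections of \<open>\<kappa> H\<close> have distances \<open>a\<close> and \<open>q\<close> from \<open>B\<close>: one of the two points at
  that distance from \<open>B\<close> on the line \<open>BH\<close> is \<open>K\<close>, and \<open>B\<close> is between \<open>H\<close> and \<open>K\<close>
  (\<open>equal_rectangles_by_scale\<close>, \<open>equal_rectangles_at_vertex_le\<close>). The remaining pairs of vertices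
  follow because opposite sides of a rectangle are congruent: reversing the base changes neither
  dimension, and equality of rectangles is symmetric.

  The rest of the theory derives from Tarski's axioms what this argument presupposes: midpoints,
  perpendiculars, the two sides of a line, the uniqueness of parallels, and line reflections.
\<close>

context euclidean_plane
begin


section \<open>Congruence and betweenness\<close>

lemma cong_refl [simp]: "seg_cong a b a b"
 using cong_inner_trans cong_pseudo_refl by blast

lemma cong_sym: "seg_cong a b c d \<Longrightarrow> seg_cong c d a b"
 using cong_refl cong_inner_trans by blast

lemma cong_trans: "seg_cong a b c d \<Longrightarrow> seg_cong c d e f \<Longrightarrow> seg_cong a b e f"
 using cong_sym cong_inner_trans by blast

lemma cong_swap [simp]: "seg_cong a b b a"
 by (metis cong_pseudo_refl)

lemma cong_left: "seg_cong a b c d \<Longrightarrow> seg_cong b a c d"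
 by (metis cong_swap cong_trans)

lemma cong_right: "seg_cong a b c d \<Longrightarrow> seg_cong a b d c"
 by (metis cong_swap cong_trans)

lemma cong_null [simp]: "seg_cong a a b b"
 by (metis cong_identity segment_construction)

lemma cong_eq_iff: "seg_cong a b c d \<Longrightarrow> a = b \<longleftrightarrow> c = d"
 by (metis cong_identity cong_sym)

lemma five_segment_add:
  assumes "bet a b c" "bet a' b' c'" "seg_cong a b a' b'" "seg_cong b c b' c'"
  shows "seg_cong a c a' c'"
proof (cases "a = b")
  case True
  thus ?thesis using assms by (metis cong_eq_iff)
next
  case False
  thus ?thesis using five_segment[of a b c a' b' c' a a'] assms
    by (meson cong_left cong_right cong_null)
qed

text \<open>
  The axiom \<open>five_segment\<close> with the degenerate choice \<open>d = x\<close> on both sides compares \<open>xx\<close> with \<open>yx\<close>.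
\<close>

lemma construction_unique:
  assumes "q \<noteq> a" "bet q a x" "bet q a y" "seg_cong a x a y"
  shows "x = y"
 by (meson assms(1,2,3,4) cong_refl cong_identity five_segment)

lemma bet_right [simp]: "bet a b b"
 using cong_identity segment_construction by blast

lemma bet_sym: "bet a b c \<Longrightarrow> bet c b a"
 by (metis bet_right bet_identity inner_pasch)

lemma bet_left [simp]: "bet a a b"
 by (simp add: bet_sym)

lemma bet_inner: "bet a b d \<Longrightarrow> bet b c d \<Longrightarrow> bet a b c"
 by (metis bet_sym bet_identity inner_pasch)

lemma bet_exchange: "bet a b c \<Longrightarrow> bet a c d \<Longrightarrow> bet b c d"
 using bet_inner bet_sym by blast

lemma bet_glue_left:
  assumes "bet a b c" "bet b c d" "b \<noteq> c" shows "bet a c d"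
proof -
  obtain x where x: "bet a c x" "seg_cong c x c d" using segment_construction by blast
  have "bet b c x" using assms x bet_exchange by blast
  hence "x = d" using assms(2,3) construction_unique x(2) by blast
  thus ?thesis using x by simp
qed

lemma bet_glue:
  assumes "bet a b c" "bet b c d" "b \<noteq> c" shows "bet a b d"
 using assms(1,2,3) bet_glue_left bet_sym by blast

lemma bet_inner2: "bet a b d \<Longrightarrow> bet b c d \<Longrightarrow> bet a c d"
 using bet_glue_left bet_inner by blast

lemma bet_exchange2: "bet a b c \<Longrightarrow> bet a c d \<Longrightarrow> bet a b d"
 using bet_inner2 bet_sym by blast

text \<open>
  Extend both configurations beyond \<open>c\<close> and \<open>c'\<close>, apply \<open>five_segment\<close> there, and come back from
  the new end points to \<open>b\<close> and \<open>b'\<close> with a second application.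
\<close>

lemma inner_five_segment:
  assumes "bet a b c" "bet a' b' c'" "seg_cong a c a' c'" "seg_cong b c b' c'"
    "seg_cong a d a' d'" "seg_cong c d c' d'"
  shows "seg_cong b d b' d'"
proof (cases "a = c")
  case True thus ?thesis using assms cong_eq_iff bet_identity by blast
next
  case False
  obtain e where e: "bet a c e" "seg_cong c e a c" using segment_construction by blast
  hence ne: "c \<noteq> e" using False by (simp add: cong_eq_iff)
  obtain e' where e': "bet a' c' e'" "seg_cong c' e' c e" using segment_construction by blast
  have "seg_cong e d e' d'" using False assms e e' by (meson cong_sym five_segment)
  moreover have "bet e c b" "bet e' c' b'" using assms e e' bet_exchange bet_sym by blast+
  ultimately show ?thesis using assms e e' ne five_segment[of e c b e' c' b' d d'] cong_right cong_sym
    by presburger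
qed

definition cong3 :: "'a \<Rightarrow> 'a \<Rightarrow> 'a \<Rightarrow> 'a \<Rightarrow> 'a \<Rightarrow> 'a \<Rightarrow> bool" where
  "cong3 a b c a' b' c' \<longleftrightarrow> seg_cong a b a' b' \<and> seg_cong a c a' c' \<and> seg_cong b c b' c'"

lemma ex_transfer_between:
  assumes "bet a b c" "seg_cong a c a' c'"
  shows "\<exists>b'. bet a' b' c' \<and> cong3 a b c a' b' c'"
proof (cases "a = c")
  case True
  thus ?thesis using assms unfolding cong3_def using bet_left cong_null bet_identity by blast
next
  case False
  hence ne: "a' \<noteq> c'" using assms cong_eq_iff by blast
  obtain d where d: "bet c' a' d" "d \<noteq> a'"
    using segment_construction[of c' a' a' c'] ne by (metis cong_eq_iff)
  obtain b' where b': "bet d a' b'" "seg_cong a' b' a b" using segment_construction by blast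
  obtain c'' where c'': "bet d b' c''" "seg_cong b' c'' b c" using segment_construction by blast
  have *: "bet a' b' c''" using b' c'' bet_exchange by blast
  have "seg_cong a' c'' a c" using "*" assms(1) b'(2) c''(2) five_segment_add by blast
  moreover have "bet d a' c''" using b'(1) bet_exchange2 c''(1) by blast
  ultimately have "c'' = c'" by (meson assms(2) bet_sym cong_trans construction_unique d(1,2))
  thus ?thesis using * b' c'' assms unfolding cong3_def using cong_sym by blast
qed

text \<open>
  The point that \<open>ex_transfer_between\<close> puts between \<open>a'\<close> and \<open>c'\<close> has the same distances from both as
  \<open>b'\<close>, and inside a segment this determines the point.
\<close>

lemma cong3_bet:
  assumes "bet a b c" "cong3 a b c a' b' c'" shows "bet a' b' c'"
proof -
  obtain b'' where b'': "bet a' b'' c'" "cong3 a b c a' b'' c'"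
    using ex_transfer_between assms unfolding cong3_def by blast
  have "seg_cong b'' b'' b'' b'"
    using b'' assms inner_five_segment[of a' b'' c' a' b'' c' b'' b'] unfolding cong3_def
    by (meson cong_right cong_inner_trans)
  hence "b'' = b'" using cong_eq_iff by blast
  thus ?thesis using b'' by simp
qed

lemma cong3_rot: "cong3 a b c a' b' c' \<Longrightarrow> cong3 b c a b' c' a'"
  unfolding cong3_def by (meson cong_left cong_right)

lemma cong3_col: "col a b c \<Longrightarrow> cong3 a b c a' b' c' \<Longrightarrow> col a' b' c'"
  by (metis cong3_rot col_def cong3_bet)

lemma cong3_ex:
  assumes "col a b c" "seg_cong a b a' b'" shows "\<exists>c'. cong3 a b c a' b' c'"
proof -
  consider "bet a b c" | "bet b c a" | "bet c a b" using assms col_def by blast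
  thus ?thesis
  proof cases
    case 1
    obtain c' where "bet a' b' c'" "seg_cong b' c' b c" using segment_construction by blast
    thus ?thesis using 1 assms unfolding cong3_def using cong_sym five_segment_add by blast
  next
    case 2
    hence "\<exists>c'. bet a' c' b' \<and> cong3 a c b a' c' b'"
      using assms ex_transfer_between bet_sym by blast
    thus ?thesis unfolding cong3_def using cong_left cong_right by blast
  next
    case 3
    obtain c' where "bet b' a' c'" "seg_cong a' c' a c" using segment_construction by blast
    thus ?thesis using 3 assms five_segment_add[of b a c b' a' c'] bet_sym unfolding cong3_def
      by (meson cong_left cong_right cong_sym)
  qed
qed

lemma col_five_segment:
  assumes "col a b c" "cong3 a b c a' b' c'" "seg_cong a d a' d'" "seg_cong b d b' d'" "a \<noteq> b"
  shows "seg_cong c d c' d'"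
proof -
  consider "bet a b c" | "bet b c a" | "bet c a b" using assms col_def by blast
  thus ?thesis
  proof cases
    case 1
    hence "bet a' b' c'" using assms cong3_bet by blast
    thus ?thesis using 1 assms five_segment[of a b c a' b' c' d d'] unfolding cong3_def by blast
  next
    case 2
    hence "bet b' c' a'" using assms cong3_bet cong3_rot by blast
    thus ?thesis using 2 assms inner_five_segment[of b c a b' c' a' d d'] cong3_rot[of a b c a' b' c']
      unfolding cong3_def by satx
  next
    case 3
    hence "bet b a c" by (rule bet_sym)
    moreover from this have "bet b' a' c'"
      using assms(2) cong3_bet[of b a c b' a' c'] unfolding cong3_def by (meson cong_left cong_right)
    ultimately show ?thesis using assms five_segment[of b a c b' a' c' d d']
      unfolding cong3_def by (metis cong_left cong_right)
  qed
qed

lemma col_equidistant: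
  assumes "a \<noteq> b" "col a b c" "seg_cong a p a q" "seg_cong b p b q"
  shows "seg_cong c p c q"
  using col_five_segment[of a b c a b c p q] assms unfolding cong3_def by simp

lemma col_point_unique:
  assumes "a \<noteq> b" "col a b c" "seg_cong a c a c'" "seg_cong b c b c'"
  shows "c = c'"
  using assms(1,2,3,4) col_equidistant cong_eq_iff by blast

text \<open>
  Gupta's theorem: order on a line is total, although no axiom says so. Extending \<open>c\<close> and \<open>d\<close> by each
  other's distance yields a configuration \<open>c\<close>, \<open>d'\<close>, \<open>c'\<close>, \<open>d\<close> with equal sides whose diagonals cross
  at \<open>e\<close>. If it were not degenerate, a copy \<open>p r q\<close> of the diagonal \<open>d' e d\<close> would have ends from which all
  points of the line, and then \<open>p\<close> itself, are equidistant: this forces \<open>p = q\<close>.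
\<close>

lemma bet_two_extensions:
  assumes ab: "a \<noteq> b" and bc: "bet a b c" and bd: "bet a b d"
  shows "bet a c d \<or> bet a d c"
proof -
  obtain c' where c': "bet a d c'" "seg_cong d c' c d" using segment_construction by blast
  obtain d' where d': "bet a c d'" "seg_cong c d' c d" using segment_construction by blast
  obtain b' where b': "bet a c' b'" "seg_cong c' b' c b" using segment_construction by blast
  obtain b'' where b'': "bet a d' b''" "seg_cong d' b'' d b" using segment_construction by blast
  have s1: "bet b c d'" using bc d' bet_exchange by blast
  have s2: "bet c d' b''" using d' b'' bet_exchange by blast
  have s3: "bet b d c'" using bd c' bet_exchange by blast
  have s4: "bet d c' b'" using c' b' bet_exchange by blast
  have "bet a b d'" "bet a b c'" using bc bd c' d' bet_exchange2 by blast+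
  hence s5: "bet a b b''" "bet a b b'" using b' b'' bet_exchange2 by blast+
  have bc'1: "bet b c' b'" using s3 s4 bd c' b' bet_exchange bet_glue_left by blast
  have bd''1: "bet b d' b''" using s1 s2 bc d' b'' bet_exchange bet_glue_left by blast
  have cb: "seg_cong b c' b'' c"
    using five_segment_add[of b d c' b'' d' c] s3 s2 bet_sym c' d' b''
    by (meson cong_left cong_sym cong_trans)
  have bb: "seg_cong b b' b'' b"
    using five_segment_add[of b c' b' b'' c b] bc'1 cb bd''1 s1 b' bet_exchange2 bet_sym by blast
  have eq: "b'' = b'" using ab s5 bb cong_right construction_unique by blast
  have f1: "cong3 b c d' b' c' d"
    using five_segment_add[of b c d' b' c' d] s1 s4 bet_sym b' c' d' unfolding cong3_def
    by (metis cong_inner_trans cong_left cong_sym)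
  have f0: "cong3 b d c' b' d' c"
    using five_segment_add[of b d c' b' d' c] s3 s2 bet_sym b'' c' d' eq unfolding cong3_def
    by (metis cong_right cong_sym cong_trans)
  have c'd': "seg_cong c' d' c d"
  proof (cases "b = c")
    case True
    hence "c' = b'" using b' cong_eq_iff by blast
    thus ?thesis using True f1 f0 b'' d' c' eq cong_left cong_right by blast
  next
    case False
    have "col b c d'" using s1 unfolding col_def by simp
    moreover have "seg_cong b c' b' c" using cb eq by simp
    moreover have "seg_cong c c' c' c" by simp
    ultimately have "seg_cong d' c' d c" using col_five_segment[of b c d' b' c' d c' c] f1 False by blast
    thus ?thesis by (meson cong_left cong_right)
  qed
  obtain e where e: "bet c e c'" "bet d e d'" using inner_pasch[of d' c b c' d] s1 s3 bet_sym by blast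
  have ed: "seg_cong e c e c'"
    using inner_five_segment[of d e d' d e d' c c'] e c' d' c'd'
    by (metis cong_inner_trans cong_refl cong_right)
  have ec: "seg_cong e d e d'"
    using inner_five_segment[of c e c' c e c' d d'] e c' d' c'd'
    by (meson ed f1 bet_sym cong3_def cong_swap cong_sym inner_five_segment)
  have "c = c' \<or> d = d'"
  proof (rule ccontr)
    assume "\<not> (c = c' \<or> d = d')"
    hence cc': "c \<noteq> c'" and dd': "d \<noteq> d'" by auto
    have cd: "c \<noteq> d'" "c \<noteq> d" using d' c' cc' dd' cong_eq_iff by blast+
    \<comment> \<open>The triangle \<open>c r p\<close> is a copy of \<open>c e d'\<close>.\<close>
    obtain p where p: "bet c' c p" "seg_cong c p c d'" using segment_construction by blast
    obtain r where r: "bet d' c r" "seg_cong c r c e" using segment_construction by blast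
    obtain q where q: "bet p r q" "seg_cong r q r p" using segment_construction by blast
    have pc: "bet p c e" using p e bet_inner bet_sym by blast
    have rp: "seg_cong r p e d'"
      using five_segment[of d' c r p c e p d'] r p pc bet_sym cd cong_left cong_swap cong_sym
      by presburger
    have rq: "seg_cong r q e d" by (meson ec cong_sym cong_trans q(2) rp)
    have pq1: "cong3 d' e d p r q" using five_segment_add[of d' e d p r q] e q rp rq
      unfolding cong3_def using bet_sym cong_left cong_sym by presburger
    have d'e: "d' \<noteq> e" using dd' ec cong_eq_iff by blast
    have ctr: "seg_cong d c q c"
      using five_segment[of d' e d p r q c c] e q pq1 d'e r p bet_sym unfolding cong3_def
      using cong_right cong_sym by presburger
    have cpq: "seg_cong c p c q" using ctr p d' by (meson cong_inner_trans cong_right cong_sym)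
    have rpq: "seg_cong r p r q" using q cong_sym by blast
    have rc: "r \<noteq> c" using r e cc' ed cong_eq_iff by blast
    have d'pq: "seg_cong d' p d' q" using col_equidistant[of r c d' p q] rc rpq cpq r bet_sym col_def
      by blast
    have bpq: "seg_cong b p b q" using col_equidistant[of c d' b p q] cd cpq d'pq s1 unfolding col_def
      by satx
    have b'pq: "seg_cong b' p b' q" using col_equidistant[of c d' b' p q] cd cpq d'pq s2 eq
      unfolding col_def by argo
    have bb': "b \<noteq> b'" using bd''1 eq s1 cd bet_identity by blast
    have c'pq: "seg_cong c' p c' q" using col_equidistant[of b b' c' p q] bb' bpq b'pq bc'1
      unfolding col_def using bet_sym by blast
    have "seg_cong p p p q" using col_equidistant[of c c' p p q] cc' cpq c'pq p unfolding col_def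
      using bet_sym by blast
    hence "p = q" using cong_eq_iff by blast
    hence "r = p" using q bet_identity by blast
    thus False using rp d'e by (simp add: cong_eq_iff)
  qed
  thus ?thesis using c' d' by auto
qed

lemma bet_two_extensions_tail:
  assumes "a \<noteq> b" "bet a b c" "bet a b d" shows "bet b c d \<or> bet b d c"
  by (meson assms(1,2,3) bet_exchange bet_two_extensions)

lemma bet_between_two:
  assumes "bet a b d" "bet a c d" shows "bet a b c \<or> bet a c b"
proof (cases "a = d")
  case True thus ?thesis using assms bet_identity by blast
next
  case False
  obtain p where p: "bet d a p" "a \<noteq> p" using segment_construction[of d a a d] False
    by (metis cong_eq_iff)
  have "bet p a b" "bet p a c" using p assms bet_inner bet_sym by blast+
  thus ?thesis using p by (metis bet_two_extensions_tail)
qed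

section \<open>Lines\<close>

lemma col_simps [simp]: "col a a b" "col a b a" "col a b b"
  unfolding col_def by simp_all

lemma col_perm: "col a b c \<Longrightarrow> col b a c" "col a b c \<Longrightarrow> col b c a" "col a b c \<Longrightarrow> col a c b"
  "col a b c \<Longrightarrow> col c a b" "col a b c \<Longrightarrow> col c b a"
  unfolding col_def by (auto dest: bet_sym)

lemma bet_col: "bet a b c \<Longrightarrow> col a b c" unfolding col_def by simp

text \<open>
  All cases of the mutual position of four points are settled by the totality of the order on a line.
\<close>

lemma col_trans:
  assumes "a \<noteq> b" "col a b c" "col a b d" shows "col a c d"
  using assms bet_two_extensions[of a b c d] bet_two_extensions[of b a c d] bet_between_two
    bet_two_extensions_tail[of a b c d] bet_two_extensions_tail[of b a c d] bet_sym bet_glue bet_glue_left bet_exchange bet_inner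
  unfolding col_def by (smt (verit, del_insts))

definition line :: "'a \<Rightarrow> 'a \<Rightarrow> 'a set" where
  "line a b = {x. col a b x}"

definition is_line :: "'a set \<Rightarrow> bool" where
  "is_line l \<longleftrightarrow> (\<exists>a b. a \<noteq> b \<and> l = line a b)"

lemma line_contains [simp]: "a \<in> line a b" "b \<in> line a b"
  unfolding line_def by simp_all

lemma is_line_line [simp]: "a \<noteq> b \<Longrightarrow> is_line (line a b)"
  unfolding is_line_def by blast

lemma line_commute: "line a b = line b a"
  unfolding line_def using col_perm by blast

lemma line_extend: "a \<noteq> b \<Longrightarrow> a \<noteq> c \<Longrightarrow> c \<in> line a b \<Longrightarrow> line a b = line a c"
  unfolding line_def using col_trans col_perm by fast

lemma line_eq: "is_line l \<Longrightarrow> a \<in> l \<Longrightarrow> b \<in> l \<Longrightarrow> a \<noteq> b \<Longrightarrow> l = line a b"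
  unfolding is_line_def using line_extend line_commute by metis

lemma line_eq_line:
  "is_line l \<Longrightarrow> is_line m \<Longrightarrow> a \<in> l \<Longrightarrow> b \<in> l \<Longrightarrow> a \<in> m \<Longrightarrow> b \<in> m \<Longrightarrow> a \<noteq> b \<Longrightarrow> l = m"
  using line_eq by blast

lemma line_col: "is_line l \<Longrightarrow> a \<in> l \<Longrightarrow> b \<in> l \<Longrightarrow> a \<noteq> b \<Longrightarrow> c \<in> l \<longleftrightarrow> col a b c"
  using line_eq[of l a b] unfolding line_def by blast

lemma line_bet:
  assumes "is_line l" "a \<in> l" "b \<in> l" "a \<noteq> b" "bet a b c \<or> bet a c b \<or> bet c a b" shows "c \<in> l"
  using assms line_col[of l a b c] col_perm unfolding col_def by metis

lemma line_ex_two: "is_line l \<Longrightarrow> \<exists>a b. a \<noteq> b \<and> a \<in> l \<and> b \<in> l"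
  unfolding is_line_def by (metis line_contains)

lemma line_ex_other: "is_line l \<Longrightarrow> \<exists>b. b \<noteq> a \<and> b \<in> l"
  using line_ex_two by metis

lemma ex_not_on_line: "is_line l \<Longrightarrow> \<exists>a. a \<notin> l"
proof -
  assume l: "is_line l"
  obtain a b c where "\<not> col a b c" using lower_dim unfolding col_def by blast
  thus ?thesis using l line_col[of l a b c] by (metis col_simps(1))
qed

definition le :: "'a \<Rightarrow> 'a \<Rightarrow> 'a \<Rightarrow> 'a \<Rightarrow> bool" where
  "le a b c d \<longleftrightarrow> (\<exists>y. bet c y d \<and> seg_cong a b c y)"

lemma le_total: "le a b c d \<or> le c d a b"
proof -
  obtain p where p: "bet b a p" "seg_cong a p c d" using segment_construction by blast
  show ?thesis
  proof (cases "c = d")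
    case True thus ?thesis unfolding le_def by (metis True bet_sym segment_construction cong_eq_iff)
  next
    case False
    obtain q where q: "bet d c q" "seg_cong c q c d" using segment_construction by blast
    obtain y where y: "bet q c y" "seg_cong c y a b" using segment_construction by blast
    have "bet c d y \<or> bet c y d" using bet_two_extensions_tail[of q c d y] q y False
      by (metis y(2) q(1) False y(1) q(2) cong_eq_iff bet_sym)
    thus ?thesis
    proof
      assume "bet c y d" thus ?thesis unfolding le_def using y cong_sym by blast
    next
      assume "bet c d y"
      thus ?thesis using ex_transfer_between[of c d y a b] y unfolding le_def cong3_def by blast
    qed
  qed
qed

section \<open>Midpoints and point reflections\<close>

definition midpoint :: "'a \<Rightarrow> 'a \<Rightarrow> 'a \<Rightarrow> bool" where
  "midpoint m a b \<longleftrightarrow> bet a m b \<and> seg_cong a m m b"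

text \<open>
  Point reflection in \<open>m\<close>. It is available as a function before midpoints are known to exist.
\<close>

definition psym :: "'a \<Rightarrow> 'a \<Rightarrow> 'a" where
  "psym m a = (SOME b. midpoint m a b)"

lemma midpoint_psym: "midpoint m a (psym m a)"
  unfolding psym_def by (rule someI_ex) (metis midpoint_def segment_construction cong_sym)

lemma midpoint_functional: "midpoint m a b \<Longrightarrow> midpoint m a c \<Longrightarrow> b = c"
  unfolding midpoint_def by (metis cong_eq_iff cong_inner_trans construction_unique)

lemma midpoint_iff: "midpoint m a b \<longleftrightarrow> b = psym m a"
  using midpoint_psym midpoint_functional by blast

lemma midpoint_commute: "midpoint m a b \<longleftrightarrow> midpoint m b a"
  unfolding midpoint_def by (metis bet_sym cong_sym cong_left)

lemma psym_psym [simp]: "psym m (psym m a) = a"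
  using midpoint_iff midpoint_commute by metis

lemma psym_eq_iff [simp]: "psym m a = psym m b \<longleftrightarrow> a = b"
  by (metis psym_psym)

lemma psym_bet [simp]: "bet a m (psym m a)" "bet (psym m a) m a"
  using midpoint_psym bet_sym unfolding midpoint_def by blast+

lemma psym_center [simp]: "seg_cong m (psym m a) m a" "seg_cong m a m (psym m a)"
  using midpoint_psym unfolding midpoint_def by (meson cong_left cong_sym)+

lemma psym_self [simp]: "psym m m = m"
  using psym_center cong_eq_iff by metis

lemma psym_fixed_iff [simp]: "psym m a = a \<longleftrightarrow> a = m"
  using psym_bet bet_identity psym_self by metis

text \<open>
  Extend \<open>p\<close> and \<open>q\<close> outwards to points \<open>x\<close>, \<open>y\<close> at the same distance from \<open>a\<close>. Then \<open>x\<close>, \<open>y\<close> and their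
  images are the vertices of a quadrilateral whose congruent diagonals bisect each other in \<open>a\<close>,
  and \<open>inner_five_segment\<close> pulls the congruences from the vertices back to \<open>p\<close> and \<open>q\<close>.
\<close>

lemma psym_isometry [simp]: "seg_cong (psym a p) (psym a q) p q"
proof (cases "p = a \<or> q = a")
  case True thus ?thesis by (metis True psym_center(1) psym_fixed_iff cong_right cong_left)
next
  case False
  let ?p = "psym a p" and ?q = "psym a q"
  have ne: "p \<noteq> ?p" "q \<noteq> ?q" "?p \<noteq> a" "?q \<noteq> a" using False
    by (metis psym_fixed_iff psym_psym)+
  obtain x where x: "bet ?p p x" "seg_cong p x q a" using segment_construction by blast
  obtain y where y: "bet ?q q y" "seg_cong q y p a" using segment_construction by blast
  obtain x' where x': "bet x ?p x'" "seg_cong ?p x' q a" using segment_construction by blast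
  obtain y' where y': "bet y ?q y'" "seg_cong ?q y' p a" using segment_construction by blast
  have b: "bet a p x" "bet a q y" using x y bet_exchange psym_bet by blast+
  have xa: "bet x a ?p" "bet y a ?q" using x y bet_exchange2 bet_sym psym_bet by blast+
  have b': "bet a ?p x'" "bet a ?q y'" using xa x' y' bet_exchange by blast+
  have b2: "bet x a x'" "bet y a y'" using xa x' y' bet_exchange2 by blast+
  have c1: "seg_cong x a y a"
    using five_segment_add[of x p a a q y] b x y bet_sym by (meson cong_left cong_sym)
  have c2: "seg_cong a x a x'"
    using five_segment_add[OF b(1) b'(1) psym_center(2)] x(2) x'(2) by (meson cong_sym cong_trans)
  have c3: "seg_cong a y a y'"
    using five_segment_add[of a q y a ?q y'] b b' y y' psym_center by (metis cong_inner_trans)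
  have nx: "x \<noteq> a" using b False by (metis b(1) b(2) False bet_identity)
  have c4: "seg_cong a x a y'" "seg_cong a x' a y" using c1 c2 c3
    by (meson cong_left cong_right cong_sym cong_trans)+
  have e1: "seg_cong x' y' y x"
    using five_segment[of x a x' y' a y y' x] nx b2(1) bet_sym[OF b2(2)] c4
    by (meson cong_left cong_right cong_sym cong_swap)
  have e2: "seg_cong q x ?q x'"
    using inner_five_segment[of y q a y' ?q a x x'] b b' bet_sym c1 c2 c3 e1 psym_center
    by (meson cong_left cong_sym)
  have "seg_cong p q ?p ?q"
    using inner_five_segment[of x p a x' ?p a q ?q] b b' bet_sym c1 c2 c3 e2 psym_center
    by (meson cong_left cong_right)
  thus ?thesis by (rule cong_sym)
qed

lemma psym_preserves_bet: "bet a b c \<Longrightarrow> bet (psym m a) (psym m b) (psym m c)"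
  using cong3_bet unfolding cong3_def by (meson cong_sym psym_isometry)

lemma psym_preserves_col: "col a b c \<Longrightarrow> col (psym m a) (psym m b) (psym m c)"
  unfolding col_def using psym_preserves_bet by blast

text \<open>
  Reflecting \<open>b\<close> in \<open>a\<close> exchanges its distances from \<open>p\<close> and \<open>q\<close>, which are equal; a point of the line
  \<open>pq\<close> is determined by them, so \<open>b\<close> is fixed.
\<close>

lemma midpoint_unique:
  assumes "midpoint a p q" "midpoint b p q" shows "a = b"
proof (cases "p = q")
  case True thus ?thesis using assms unfolding midpoint_def using bet_identity by blast
next
  case False
  have q: "q = psym a p" using assms midpoint_iff by simp
  have pq: "seg_cong p b q b" using assms(2) unfolding midpoint_def using cong_right by blast
  have "seg_cong p b p (psym a b)"
    using pq q psym_isometry[of a p "psym a b"] by (metis cong_trans psym_psym)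
  moreover have "seg_cong q b q (psym a b)"
    using pq q psym_isometry[of a p b] cong_sym cong_trans by blast
  moreover have "col p q b" using assms(2) unfolding midpoint_def col_def by (simp add: bet_sym)
  ultimately have "b = psym a b" using False col_point_unique by blast
  thus ?thesis by (metis psym_fixed_iff)
qed

text \<open>
  If \<open>m\<close> were outside the segment, both ends would be at the same distance on one ray from \<open>m\<close>.
\<close>

lemma col_equidistant_midpoint:
  assumes "col a m b" "seg_cong m a m b" "a \<noteq> b" shows "midpoint m a b"
proof -
  consider "bet a m b" | "bet m a b" | "bet m b a" using assms(1) unfolding col_def using bet_sym
    by blast
  thus ?thesis
  proof cases
    case 1 thus ?thesis using assms unfolding midpoint_def by (meson cong_left)
  next
    case 2
    obtain c where "bet b m c" "c \<noteq> m" using assms segment_construction[of b m m b]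
      by (metis assms(3) assms(1) assms(2) cong_eq_iff)
    thus ?thesis using 2 assms construction_unique[of c m a b] by (metis assms(3) bet_sym bet_exchange)
  next
    case 3
    obtain c where "bet a m c" "c \<noteq> m" using assms segment_construction[of a m m a]
      by (metis assms(3) assms(1) assms(2) cong_eq_iff)
    thus ?thesis using 3 assms construction_unique[of c m a b] by (metis assms(3) bet_sym bet_exchange)
  qed
qed

text \<open>
  Extend the equal sides equally to \<open>p\<close> and \<open>q\<close>; by symmetry the diagonals of the trapezoid meet in a
  point \<open>r\<close> equidistant from \<open>a\<close> and \<open>b\<close>, and the line \<open>cr\<close> cuts \<open>ab\<close> in its midpoint. Midpoints of
  arbitrary segments need perpendiculars first.
\<close>

lemma isosceles_midpoint:
  assumes "seg_cong c a c b" shows "\<exists>x. midpoint x a b"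
proof (cases "col a c b")
  case True
  thus ?thesis using assms col_equidistant_midpoint[of a c b] by (metis midpoint_iff psym_self)
next
  case False
  hence ne: "a \<noteq> b" "a \<noteq> c" "b \<noteq> c" by auto
  obtain p where p: "bet c a p" "seg_cong a p a c" using segment_construction by blast
  obtain q where q: "bet c b q" "seg_cong b q a p" using segment_construction by blast
  have ap: "a \<noteq> p" using p ne by (metis ne(1) ne(2) p(1) p(2) ne(3) cong_eq_iff)
  obtain r where r: "bet a r q" "bet b r p" using inner_pasch[of p a c q b] p q bet_sym by blast
  obtain x where x: "bet a x b" "bet r x c" using inner_pasch[of c a p b r] p r by blast
  have pb: "seg_cong p b q a"
    using five_segment[of c a p c b q b a] p q ne assms
    by (metis ne(2) ne(3) q(1) q(2) p(1) p(2) ne(1) assms cong_inner_trans cong_swap)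
  obtain r' where r': "bet a r' q" "cong3 b r p a r' q"
    using ex_transfer_between[of b r p a q] r pb by (metis pb r(2) r(1) cong_right cong_left)
  have e1: "seg_cong r a r' b"
    using inner_five_segment[of b r p a r' q a b] r r' pb p q unfolding cong3_def
    using cong_right cong_swap cong_sym by presburger
  have e2: "seg_cong r q r' p"
    using inner_five_segment[of b r p a r' q q p] r r' pb p q unfolding cong3_def by simp
  have "cong3 a r q b r' p" using e1 e2 pb unfolding cong3_def by (metis pb e2 e1 cong_right cong_sym)
  hence b': "bet b r' p" using r cong3_bet by blast
  have "r = r'"
  proof (rule ccontr)
    assume n: "r \<noteq> r'"
    have "is_line (line r r')" using n by simp
    have "a \<noteq> q" "b \<noteq> p" using False p q bet_col col_perm by blast+
    have "r \<in> line a q" "r' \<in> line a q" "r \<in> line b p" "r' \<in> line b p"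
      using r r' b' bet_col col_perm(3) unfolding line_def by blast+
    hence "line a q = line b p"
      using line_eq_line[of "line a q" "line b p" r r'] n \<open>a \<noteq> q\<close> \<open>b \<noteq> p\<close> is_line_line by blast
    hence "col a b p" using col_perm(4) line_contains(1) line_def by blast
    hence "col a p b" by (rule col_perm(3))
    moreover have "col a p c" using p bet_col col_perm(2) by blast
    ultimately have "col a b c" using ap col_trans by blast
    thus False using False col_perm(3) by blast
  qed
  hence ra: "seg_cong r a r b" using e1 by simp
  have "r \<noteq> c" using r p q False ap bet_col bet_identity x(1,2) by blast
  hence "seg_cong x a x b" using col_equidistant[of r c x a b] ra assms x
    by (simp add: bet_col col_perm(3))
  thus ?thesis using x unfolding midpoint_def by (meson cong_left)
qed

text \<open>
  The congruence class of a segment: congruence becomes equality.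
\<close>

definition len :: "'a \<Rightarrow> 'a \<Rightarrow> ('a \<times> 'a) set" where
  "len a b = {(x, y). seg_cong a b x y}"

lemma len_commute: "len a b = len b a"
  unfolding len_def using cong_left by blast

lemma cong_len: "seg_cong a b c d \<longleftrightarrow> len a b = len c d"
  unfolding len_def using cong_refl cong_sym cong_trans by blast

lemma bet_cong_eq: assumes "bet c u b" "seg_cong c u c b" shows "u = b"
proof (cases "c = u")
  case True thus ?thesis using assms cong_eq_iff by blast
next
  case False
  have "bet (psym c u) c u" "bet (psym c u) c b" using bet_glue[of "psym c u" c u b] assms False by auto
  thus ?thesis using construction_unique[of "psym c u" c u b] False assms
    by (metis psym_fixed_iff psym_psym)
qed

section \<open>Right angles and perpendiculars\<close>

text \<open>
  Unlike \<open>right_angle\<close> this admits degenerate sides, so that feet of perpendiculars need no case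
  distinction.
\<close>

definition per :: "'a \<Rightarrow> 'a \<Rightarrow> 'a \<Rightarrow> bool" where
  "per a b c \<longleftrightarrow> seg_cong a c a (psym b c)"

lemma per_trivial [simp]: "per a b b" "per b b a"
  unfolding per_def by simp_all

lemma per_sym: "per a b c \<Longrightarrow> per c b a"
  unfolding per_def using psym_isometry[of b a "psym b c"]
  by (metis cong_right cong_sym cong_trans psym_psym)

lemma per_col: "per a b c \<Longrightarrow> a \<noteq> b \<Longrightarrow> col a b a' \<Longrightarrow> per a' b c"
  unfolding per_def using col_equidistant[of a b a' c "psym b c"] by simp

lemma per_right_col: "per a b c \<Longrightarrow> c \<noteq> b \<Longrightarrow> col c b c' \<Longrightarrow> per a b c'"
  using per_sym per_col by blast

lemma per_psym: "per a b c \<Longrightarrow> per (psym m a) (psym m b) (psym m c)"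
proof -
  assume "per a b c"
  moreover have "seg_cong (psym m c) (psym m b) (psym m b) (psym m (psym b c))"
    by (metis cong_len len_commute psym_isometry psym_center(1))
  hence "psym m (psym b c) = psym (psym m b) (psym m c)"
    using midpoint_iff[of "psym m b" "psym m c" "psym m (psym b c)"] psym_preserves_bet[of c b "psym b c" m]
    unfolding midpoint_def by simp
  ultimately show ?thesis unfolding per_def by (metis cong_len psym_isometry)
qed

text \<open>
  Both \<open>a\<close> and \<open>a'\<close> are equidistant from \<open>c\<close> and its reflection, hence so is the point \<open>c\<close> between them.
\<close>

lemma per_between_degenerate:
  assumes "per a b c" "per a' b c" "bet a c a'" shows "b = c"
proof (cases "a = a'")
  case True
  hence "a = c" using assms(3) bet_identity by blast
  thus ?thesis using assms(1) unfolding per_def by (metis cong_eq_iff psym_fixed_iff)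
next
  case False
  have "seg_cong c c c (psym b c)"
    using col_equidistant[of a a' c c "psym b c"] False assms unfolding per_def col_def using bet_sym
    by blast
  thus ?thesis by (metis cong_eq_iff psym_fixed_iff)
qed

text \<open>
  A triangle has at most one right angle: with two of them, \<open>a\<close> and its reflection in \<open>c\<close> would both be
  equidistant from \<open>c\<close> and the reflection of \<open>c\<close> in \<open>b\<close>.
\<close>

lemma per_unique_foot: assumes "per a b c" "per a c b" shows "b = c"
proof (rule ccontr)
  assume n: "b \<noteq> c"
  let ?c = "psym b c" and ?a = "psym c a"
  have "?c \<noteq> c" using n by simp
  have "per b c a" using assms(2) per_sym by blast
  hence "per ?c c a" using per_col[of b c a ?c] n by (simp add: col_def)
  hence 1: "seg_cong ?c a ?c ?a" unfolding per_def .
  have "seg_cong ?a c ?a ?c" using 1 assms(1) psym_center[of c a] unfolding per_def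
    by (metis cong_len cong_swap)
  hence "per ?a b c" unfolding per_def .
  thus False using per_between_degenerate[of a b c ?a] assms(1) n by simp
qed

definition mid :: "'a \<Rightarrow> 'a \<Rightarrow> 'a" where
  "mid a b = (SOME m. midpoint m a b)"

text \<open>
  Orthogonal projection onto the line \<open>l\<close>; the choice is unique by \<open>foot_unique\<close> below.
\<close>

definition foot :: "'a set \<Rightarrow> 'a \<Rightarrow> 'a" where
  "foot l c = (SOME f. f \<in> l \<and> (\<forall>x\<in>l. per x f c))"

text \<open>
  For a point off the line, the circle about it through a point beyond the line meets the line twice
  by line-circle continuity; the two intersections form an isosceles triangle with the centre.
\<close>

lemma ex_foot:
  assumes l: "is_line l" shows "\<exists>f\<in>l. \<forall>x\<in>l. per x f c"
proof (cases "c \<in> l")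
  case True thus ?thesis by (intro bexI[of _ c]) simp_all
next
  case False
  obtain u v where uv: "u \<noteq> v" "u \<in> l" "v \<in> l" using line_ex_two l by blast
  hence ll: "l = line u v" using l line_eq by blast
  have cu: "c \<noteq> u" using False uv by blast
  \<comment> \<open>Any circle reaching beyond \<open>u\<close> will do; twice the distance is a convenient radius.\<close>
  obtain b where b: "bet c u b" "seg_cong u b c u" using segment_construction by blast
  have ub: "u \<noteq> b" using cong_eq_iff[OF b(2)] cu by blast
  have "bet u v u \<or> bet v u u \<or> bet u u v" by simp
  from line_circle[OF uv(1) this b(1) ub] obtain x y where
    xy: "bet u v x \<or> bet v x u \<or> bet x u v" "bet u v y \<or> bet v y u \<or> bet y u v"
    "seg_cong c x c b" "seg_cong c y c b" "bet x u y" by blast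
  have xl: "x \<in> l" "y \<in> l" using xy ll unfolding line_def col_def by auto
  have "x \<noteq> y"
  proof
    assume "x = y"
    hence "seg_cong c u c b" using xy bet_identity by blast
    thus False using bet_cong_eq b ub by blast
  qed
  have "seg_cong c x c y" using cong_trans[OF xy(3) cong_sym[OF xy(4)]] .
  then obtain f where f: "midpoint f x y" using isosceles_midpoint by blast
  have fy: "y = psym f x" using f midpoint_iff by simp
  have xf: "x \<noteq> f" using fy \<open>x \<noteq> y\<close> by auto
  have fl: "f \<in> l" using f xl \<open>x \<noteq> y\<close> l line_bet[of l x y f]
    unfolding midpoint_def by blast
  have "per c f x" using \<open>seg_cong c x c y\<close> fy unfolding per_def by simp
  hence "per x f c" by (rule per_sym)
  hence "\<forall>z\<in>l. per z f c" using per_col xf l line_col fl xl by blast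
  thus ?thesis using fl by (intro bexI[of _ f])
qed

lemma foot_in: "is_line l \<Longrightarrow> foot l c \<in> l"
  and foot_per: "is_line l \<Longrightarrow> x \<in> l \<Longrightarrow> per x (foot l c) c"
  using someI_ex[of "\<lambda>f. f \<in> l \<and> (\<forall>x\<in>l. per x f c)"] ex_foot[of l c]
  unfolding foot_def by blast+

lemma foot_unique:
  assumes "is_line l" "f \<in> l" "x \<in> l" "x \<noteq> f" "per x f c" shows "foot l c = f"
proof -
  have "per (foot l c) f c" using assms per_col line_col foot_in by metis
  moreover have "per f (foot l c) c" using assms foot_per by blast
  ultimately show ?thesis using per_unique_foot per_sym by blast
qed

lemma foot_self [simp]: "is_line l \<Longrightarrow> c \<in> l \<Longrightarrow> foot l c = c"
  using foot_unique line_ex_other per_trivial by blast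

lemma foot_eq_iff: "is_line l \<Longrightarrow> foot l c = c \<longleftrightarrow> c \<in> l"
  using foot_in foot_self by metis

lemma foot_eqI: "is_line l \<Longrightarrow> f \<in> l \<Longrightarrow> (\<And>x. x \<in> l \<Longrightarrow> per x f c) \<Longrightarrow> foot l c = f"
  using foot_unique line_ex_other by metis

lemma line_psym: "is_line l \<Longrightarrow> m \<in> l \<Longrightarrow> a \<in> l \<Longrightarrow> psym m a \<in> l"
  using line_bet[of l a m "psym m a"] by (metis psym_bet(1) psym_self)

lemma foot_psym:
  assumes "is_line l" "x \<in> l" shows "foot l (psym x p) = psym x (foot l p)"
proof -
  have "per y (psym x (foot l p)) (psym x p)" if "y \<in> l" for y
    using per_psym[OF foot_per[OF assms(1) line_psym[OF assms that]], of x p] by simp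
  thus ?thesis using foot_eqI[OF assms(1) line_psym[OF assms foot_in[OF assms(1)]]] by blast
qed

text \<open>
  As a fibre of the projection, the perpendicular makes disjointness of two perpendiculars immediate; that
  it is a line is \<open>is_line_perp_at\<close>.
\<close>

definition perp_at :: "'a set \<Rightarrow> 'a \<Rightarrow> 'a set" where
  "perp_at l p = {y. foot l y = p}"

text \<open>
  Reflect \<open>c\<close> in \<open>a\<close> and in \<open>b\<close>. Both images are as far from \<open>a\<close> as \<open>c\<close> is, so they are the base of an
  isosceles triangle with apex \<open>a\<close>; its base is parallel to \<open>ab\<close>, so the midpoint \<open>p\<close> of the base lies on the
  perpendicular at \<open>a\<close>. Two applications of Pasch's axiom show that \<open>p\<close> and \<open>c\<close> are on different
  sides of \<open>ab\<close>, as needed for constructing midpoints.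
\<close>

lemma ex_perp_crossing:
  assumes "per a b c" "a \<noteq> b" "b \<noteq> c"
  shows "\<exists>p t. per b a p \<and> p \<noteq> a \<and> bet a t b \<and> bet p t c"
proof -
  let ?c = "psym a c" and ?d = "psym b c"
  have ac: "a \<noteq> c" using assms per_unique_foot by force
  have cd: "seg_cong a ?c a ?d" using assms(1) psym_center[of a c] unfolding per_def using cong_trans
    by blast
  then obtain p where p: "midpoint p ?c ?d" using isosceles_midpoint by blast
  have pp: "bet ?c p ?d" "seg_cong ?c p ?d p" using p unfolding midpoint_def by (auto intro: cong_right)
  let ?b = "psym a b" and ?e = "psym a ?d"
  have b1: "bet ?c ?b ?e" by (intro psym_preserves_bet) simp
  have cp: "seg_cong c p ?e p"
    using five_segment[of ?c a c ?d a ?e p p] ac pp cd psym_center[of a c] psym_center[of a ?d]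
    by (metis cong_eq_iff cong_left cong_refl cong_trans psym_bet(1,2))
  have "seg_cong ?d b ?c ?b"
    using psym_isometry[of a c b] psym_center[of b c] by (meson cong_right cong_sym cong_trans)
  moreover have dc: "seg_cong ?d c ?c ?e" using psym_isometry[of a c ?d] cong_right cong_sym by blast
  moreover have "seg_cong b c ?b ?e"
    using psym_isometry[of a b ?d] psym_center[of b c] cong_sym cong_trans by blast
  moreover have "seg_cong ?d p ?c p" using pp cong_sym by blast
  ultimately have "seg_cong b p ?b p"
    using inner_five_segment[of ?d b c ?c ?b ?e p p] b1 cp by simp
  hence "per p a b" unfolding per_def by (meson cong_left cong_right)
  hence per: "per b a p" by (rule per_sym)
  have "p \<noteq> a"
  proof
    assume "p = a"
    hence "?d = c" using p midpoint_iff by simp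
    thus False using assms(3) by simp
  qed
  obtain s where s: "bet p s c" "bet a s ?d"
    using inner_pasch[of ?d p ?c c a] pp bet_sym by auto
  obtain t where t: "bet s t c" "bet b t a"
    using inner_pasch[of a s ?d c b] s by auto
  have "bet p t c" using s t bet_inner2 by blast
  thus ?thesis using per \<open>p \<noteq> a\<close> t bet_sym by blast
qed

lemma ex_perp_point:
  assumes "is_line l" "p \<in> l" shows "\<exists>y. y \<noteq> p \<and> foot l y = p"
proof -
  obtain c where c: "c \<notin> l" using assms ex_not_on_line by blast
  show ?thesis
  proof (cases "foot l c = p")
    case True thus ?thesis using c assms by metis
  next
    case False
    let ?f = "foot l c"
    have f: "?f \<in> l" "?f \<noteq> c" using assms c foot_in foot_eq_iff by auto
    have "per p ?f c" using assms foot_per by blast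
    then obtain y where "per ?f p y" "y \<noteq> p" using ex_perp_crossing False f by metis
    thus ?thesis using foot_unique[of l p ?f y] assms f False by blast
  qed
qed

text \<open>
  All points over \<open>p\<close> are equidistant from \<open>x\<close> and its reflection in \<open>p\<close>, hence collinear by the
  upper dimension axiom.
\<close>

lemma is_line_perp_at:
  assumes "is_line l" "p \<in> l" shows "is_line (perp_at l p)"
proof -
  obtain y0 where y0: "y0 \<noteq> p" "foot l y0 = p" using ex_perp_point[OF assms] by metis
  obtain x where x: "x \<noteq> p" "x \<in> l" using line_ex_other[OF assms(1), of p] by metis
  have "perp_at l p = line p y0"
  proof (intro set_eqI iffI)
    fix y assume "y \<in> perp_at l p"
    hence "per x p y" "per x p y0" using foot_per[of l x y] foot_per[of l x y0] assms x y0
      unfolding perp_at_def by auto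
    hence "seg_cong y x y (psym p x)" "seg_cong y0 x y0 (psym p x)" using per_sym unfolding per_def
      by blast+
    thus "y \<in> line p y0" unfolding line_def col_def
      using upper_dim[of x "psym p x" p y0 y] x psym_center by (metis mem_Collect_eq psym_fixed_iff)
  next
    fix y assume "y \<in> line p y0"
    hence "col y0 p y" unfolding line_def using col_perm by blast
    moreover have "per x p y0" using foot_per[of l x y0] assms x y0 by auto
    ultimately have "per x p y" using per_right_col y0 by blast
    thus "y \<in> perp_at l p" using foot_unique[of l p x y] assms x unfolding perp_at_def by blast
  qed
  thus ?thesis using y0 by simp
qed

lemma perp_at_contains [simp]: "is_line l \<Longrightarrow> p \<in> l \<Longrightarrow> p \<in> perp_at l p"
  unfolding perp_at_def by simp

text \<open>
  Points equidistant from \<open>r\<close> and \<open>s\<close> are collinear with their midpoint, so the midpoint is on \<open>l\<close>.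
\<close>

lemma reflection_unique:
  assumes "is_line l" "a \<in> l" "b \<in> l" "a \<noteq> b" "seg_cong a r a s" "seg_cong b r b s" "r \<noteq> s"
  shows "s = psym (foot l r) r"
proof -
  obtain m where m: "midpoint m r s" using isosceles_midpoint assms by blast
  have s: "s = psym m r" using m midpoint_iff by blast
  have "seg_cong m r m s" using s by simp
  hence "col a b m" using upper_dim[of r s a b m] assms unfolding col_def by blast
  hence ml: "m \<in> l" using line_col assms by blast
  have "per a m r" "per b m r" using assms s unfolding per_def by auto
  hence "foot l r = m" using foot_unique ml assms by metis
  thus ?thesis using s by simp
qed

text \<open>
  Opposite sides are congruent, so exchanging \<open>b\<close> with \<open>d\<close> and \<open>a\<close> with \<open>c\<close> preserves all distances;
  the point corresponding to \<open>p\<close> is again the intersection of the diagonals, that is, \<open>p\<close> itself.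
\<close>

lemma crossing_quadrilateral:
  assumes ncol: "\<not> col a b c" and "seg_cong a b c d" "seg_cong b c d a" "col a p c" "col b p d" "b \<noteq> d"
  shows "midpoint p a c"
proof -
  obtain q where q: "cong3 b d p d b q" using cong3_ex[of b d p d b] col_perm(3)[OF assms(5)] by auto
  have dq: "col d b q" using cong3_col[OF col_perm(3)[OF assms(5)] q] .
  have pa: "seg_cong p a q c"
    using col_five_segment[of b d p d b q a c] q assms col_perm(3) cong_left cong_sym by presburger
  have pc: "seg_cong p c q a" using col_five_segment[of b d p d b q c a] q assms
    by (meson col_perm(3) cong_left cong_sym)
  have "cong3 a p c c q a" using pa pc unfolding cong3_def using cong_left cong_right cong_swap by blast
  hence aq: "col c q a" using assms cong3_col by blast
  have "p = q"
  proof (rule ccontr)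
    assume "p \<noteq> q"
    have "a \<noteq> c" using ncol by auto
    have "p \<in> line a c" "q \<in> line a c" "p \<in> line b d" "q \<in> line b d"
      using assms(4,5) aq dq col_perm unfolding line_def by blast+
    hence "line a c = line b d"
      using line_eq_line[of "line a c" "line b d" p q] \<open>p \<noteq> q\<close> \<open>a \<noteq> c\<close> assms(6) by simp
    hence "b \<in> line a c" by simp
    hence "col a b c" unfolding line_def using col_perm(3) by simp
    thus False using ncol by simp
  qed
  hence "seg_cong p a p c" using pa by simp
  thus ?thesis using col_equidistant_midpoint[of a p c] assms(4) ncol by (metis col_simps(2))
qed

text \<open>
  The reflections \<open>?p\<close> and \<open>r'\<close> of \<open>p\<close> and \<open>r\<close> in \<open>l\<close> complete a quadrilateral with diagonals through
  \<open>x\<close>. It has opposite sides congruent, so \<open>crossing_quadrilateral\<close> applies. Reflections in a line are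
  not yet known to be isometries, whence \<open>r'\<close> is constructed on the line \<open>?p x\<close> and recognised later.
\<close>

lemma equal_perpendiculars_cross:
  assumes l: "is_line l" and p: "p \<notin> l" and a: "foot l p = a" and b: "foot l r = b" and ab: "a \<noteq> b"
    and ap: "seg_cong a p b r" and x: "x \<in> l" "bet p x r"
  shows "r = psym x p"
proof -
  have al: "a \<in> l" "b \<in> l" using l a b foot_in by blast+
  have apn: "a \<noteq> p" using p al by blast
  hence br: "b \<noteq> r" using ap cong_eq_iff by blast
  hence rl: "r \<notin> l" using l b foot_self by metis
  have pr: "p \<noteq> r" using a b ab by blast
  have xa: "x \<noteq> a"
  proof
    assume "x = a"
    hence "r \<in> perp_at l a" using line_bet[OF is_line_perp_at[of l a], of p a r] l al x a apn
      unfolding perp_at_def by auto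
    thus False using b ab unfolding perp_at_def by auto
  qed
  let ?p = "psym a p"
  have xp: "seg_cong x p x ?p" using foot_per[OF l x(1), of p] a unfolding per_def by simp
  have pn: "x \<noteq> p" "x \<noteq> ?p" using x p xp cong_eq_iff by metis+
  obtain r' where r': "bet ?p x r'" "seg_cong x r' x r" using segment_construction by blast
  have e1: "seg_cong p r' ?p r"
    using five_segment[of ?p x r' p x r p ?p] pn r' x xp bet_sym by (metis cong_swap cong_sym cong_trans)
  have e2: "seg_cong p r ?p r'" using five_segment_add[of p x r ?p x r'] x r' xp
    by (meson cong_left cong_sym)
  have ar: "seg_cong a r a r'"
    using inner_five_segment[of p a ?p ?p a p r r'] e1 e2 bet_sym cong_swap cong_sym psym_bet(1) psym_center(1) by blast
  have r's: "r' = psym b r"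
  proof (cases "r = r'")
    case True
    hence "bet r x p" "bet r x ?p" using r'(1) x(2) bet_sym by blast+
    moreover have "r \<noteq> x" using rl x(1) by blast
    ultimately have "?p = p" using construction_unique[of r x p ?p] xp by simp
    thus ?thesis using apn by simp
  next
    case False
    thus ?thesis using reflection_unique[of l a x r r'] l al x(1) xa ar r'(2) b cong_sym by metis
  qed
  have c1: "seg_cong p ?p r r'"
    using five_segment_add[of p a ?p r b r'] r's ap
    by (metis cong_len cong_swap psym_bet(1) psym_center(1))
  have nc: "\<not> col p ?p r"
  proof
    assume "col p ?p r"
    hence "r \<in> line p ?p" unfolding line_def by simp
    moreover have "line p ?p = perp_at l a"
      using line_eq[OF is_line_perp_at[of l a], of p ?p] l al a apn foot_psym[of l a p]
      unfolding perp_at_def by (metis mem_Collect_eq psym_fixed_iff psym_self)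
    ultimately show False using b ab unfolding perp_at_def by auto
  qed
  have "?p \<noteq> r'" using r's ab foot_psym[OF l al(1), of p] foot_psym[OF l al(2), of r] a b by auto
  hence "midpoint x p r"
    using crossing_quadrilateral[of p ?p r r' x] nc c1 e1 x(2) r'(1) bet_col cong_right cong_sym by blast
  thus ?thesis using midpoint_iff by simp
qed

text \<open>
  Erect perpendiculars at \<open>a\<close> and \<open>b\<close> towards different sides and shorten the longer one to the length
  of the other; then the crossing point of the connecting segment with \<open>ab\<close> is the midpoint.
\<close>

lemma ex_midpoint: "\<exists>m. midpoint m a b"
proof (cases "a = b")
  case True thus ?thesis using midpoint_iff psym_self by metis
next
  case False
  let ?l = "line a b"
  have l: "is_line ?l" "a \<in> ?l" "b \<in> ?l" using False by auto
  obtain q where q: "q \<noteq> b" "foot ?l q = b" using ex_perp_point l by blast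
  have "per a b q" using foot_per[OF l(1,2), of q] q by simp
  then obtain p u where p: "per b a p" "p \<noteq> a" "bet a u b" "bet p u q"
    using ex_perp_crossing False q by metis
  have fp: "foot ?l p = a" using foot_unique[of ?l a b p] l False p by blast
  have pl: "p \<notin> ?l" "q \<notin> ?l" using fp p q l foot_self by metis+
  have "le a p b q \<or> le b q a p" by (rule le_total)
  thus ?thesis
  proof
    assume "le a p b q"
    then obtain r where r: "bet b r q" "seg_cong a p b r" unfolding le_def by blast
    obtain x where x: "bet u x b" "bet r x p" using inner_pasch[of p u q b r] p r by blast
    have "u \<in> ?l" using p(3) unfolding line_def col_def by (simp add: bet_sym)
    hence "x \<in> ?l" using x l line_bet[of ?l u _ x] bet_identity by metis
    moreover have "r \<noteq> b" using r p cong_eq_iff by metis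
    hence "foot ?l r = b" using line_bet[OF is_line_perp_at[of ?l b], of b q r] l q r
      unfolding perp_at_def by auto
    ultimately have "r = psym x p"
      using equal_perpendiculars_cross[of ?l p a r b x] l pl fp False r x bet_sym by blast
    hence "b = psym x a" using foot_psym[of ?l x p] l \<open>x \<in> ?l\<close> fp \<open>foot ?l r = b\<close> by simp
    thus ?thesis using midpoint_iff by blast
  next
    assume "le b q a p"
    then obtain r where r: "bet a r p" "seg_cong b q a r" unfolding le_def by blast
    obtain x where x: "bet u x a" "bet r x q" using inner_pasch[of q u p a r] p r bet_sym by blast
    have "u \<in> ?l" using p(3) unfolding line_def col_def by (simp add: bet_sym)
    hence "x \<in> ?l" using x l line_bet[of ?l u _ x] bet_identity by metis
    moreover have "r \<noteq> a" using r q cong_eq_iff by metis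
    hence "foot ?l r = a" using line_bet[OF is_line_perp_at[of ?l a], of a p r] l fp p r
      unfolding perp_at_def by auto
    ultimately have "r = psym x q"
      using equal_perpendiculars_cross[of ?l q b r a x] l pl q False r x bet_sym by blast
    hence "a = psym x b" using foot_psym[of ?l x q] l \<open>x \<in> ?l\<close> q \<open>foot ?l r = a\<close> by simp
    thus ?thesis using midpoint_iff midpoint_commute by blast
  qed
qed

lemma midpoint_mid: "midpoint (mid a b) a b"
  unfolding mid_def using ex_midpoint by (rule someI_ex)

lemma mid_iff: "mid a b = m \<longleftrightarrow> midpoint m a b"
  using midpoint_mid midpoint_unique by blast

lemma mid_psym [simp]: "mid a (psym m a) = m"
  using mid_iff midpoint_psym by blast

lemma psym_mid [simp]: "psym (mid a b) a = b" "psym (mid a b) b = a"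
  using midpoint_mid midpoint_iff midpoint_commute by metis+

lemma mid_commute: "mid a b = mid b a"
  using mid_iff midpoint_mid midpoint_commute by blast

lemma mid_self [simp]: "mid a a = a" using mid_psym[of a a] by simp

lemma mid_bet: "bet a (mid a b) b" using midpoint_mid unfolding midpoint_def by blast

lemma mid_in_line: "is_line l \<Longrightarrow> a \<in> l \<Longrightarrow> b \<in> l \<Longrightarrow> mid a b \<in> l"
  using line_bet[of l a b "mid a b"] mid_bet by (metis mid_self)

lemma psym_eq_center [simp]: "psym m a = m \<longleftrightarrow> a = m"
  by (metis psym_psym psym_self)

section \<open>The two sides of a line\<close>

definition out :: "'a \<Rightarrow> 'a \<Rightarrow> 'a \<Rightarrow> bool" where
  "out p a b \<longleftrightarrow> a \<noteq> p \<and> b \<noteq> p \<and> (bet p a b \<or> bet p b a)"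

definition opp :: "'a set \<Rightarrow> 'a \<Rightarrow> 'a \<Rightarrow> bool" where
  "opp l a b \<longleftrightarrow> a \<notin> l \<and> b \<notin> l \<and> (\<exists>t\<in>l. bet a t b)"

lemma out_sym: "out p a b \<Longrightarrow> out p b a"
  unfolding out_def by blast

lemma out_trans: "out p a b \<Longrightarrow> out p b c \<Longrightarrow> out p a c"
  using bet_two_extensions[of p b a c] bet_between_two[of p a b c] bet_exchange2[of p a b c] bet_exchange2[of p c b a]
  unfolding out_def by blast

lemma bet_out: "bet a p b \<Longrightarrow> bet c p b \<Longrightarrow> a \<noteq> p \<Longrightarrow> b \<noteq> p \<Longrightarrow> c \<noteq> p \<Longrightarrow> out p a c"
  using bet_two_extensions_tail[of b p a c] bet_sym unfolding out_def by blast

lemma out_bet: "out p a b \<Longrightarrow> bet a p c \<Longrightarrow> bet b p c"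
  unfolding out_def using bet_glue bet_inner bet_sym by blast

lemma opp_sym: "opp l a b \<Longrightarrow> opp l b a"
  unfolding opp_def using bet_sym by blast

lemma opp_psym: "m \<in> l \<Longrightarrow> a \<notin> l \<Longrightarrow> is_line l \<Longrightarrow> opp l a (psym m a)"
  unfolding opp_def using line_psym[of l m "psym m a"] psym_bet by (metis psym_psym)

lemma ray_not_in_line:
  assumes "is_line l" "r \<in> l" "a \<notin> l" "out r a b" shows "b \<notin> l"
  using assms line_bet[of l r b a] unfolding out_def by blast

text \<open>
  The two cases, \<open>b\<close> before and \<open>b\<close> beyond \<open>a\<close> on the ray, are two instances of Pasch's axiom, the
  second one after reflecting the ray in \<open>m\<close>.
\<close>

lemma opp_psym_ray:
  assumes l: "is_line l" "m \<in> l" "r \<in> l" and a: "a \<notin> l" and o: "out r a b"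
  shows "opp l b (psym m a)"
proof -
  have n: "b \<notin> l" "psym m a \<notin> l" using ray_not_in_line assms opp_psym unfolding opp_def
    by blast+
  have "bet r b a \<or> bet r a b" using o unfolding out_def by blast
  hence "\<exists>t\<in>l. bet b t (psym m a)"
  proof
    assume "bet r b a"
    then obtain t where t: "bet b t (psym m a)" "bet m t r"
      using inner_pasch[of r b a "psym m a" m] by auto
    thus ?thesis using line_bet[of l m r t] l bet_identity by metis
  next
    assume "bet r a b"
    hence "bet (psym m r) (psym m a) (psym m b)" by (rule psym_preserves_bet)
    then obtain t where t: "bet m t (psym m r)" "bet (psym m a) t b"
      using inner_pasch[of b m "psym m b" "psym m r" "psym m a"] by auto
    have "psym m r \<in> l" using l line_psym by blast
    hence "t \<in> l" using line_bet[of l m "psym m r" t] l t bet_identity by metis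
    thus ?thesis using t bet_sym by blast
  qed
  thus ?thesis using n unfolding opp_def by blast
qed

text \<open>
  A normal form for \<open>opp\<close>: reflecting \<open>a\<close> in the midpoint of the two feet moves it to the perpendicular
  through \<open>c\<close>, where opposite sides become the same ray. By \<open>le_total\<close> one of the perpendiculars can be
  shortened to the length of the other, and then \<open>equal_perpendiculars_cross\<close> identifies that midpoint.
\<close>

lemma opp_imp_out:
  assumes l: "is_line l" and o: "opp l a c"
  shows "out (foot l c) c (psym (mid (foot l a) (foot l c)) a)"
proof -
  let ?r = "foot l a" and ?s = "foot l c"
  have n: "a \<notin> l" "c \<notin> l" using o unfolding opp_def by auto
  obtain t where t: "t \<in> l" "bet a t c" using o unfolding opp_def by blast
  have fl: "?r \<in> l" "?s \<in> l" using l foot_in by auto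
  have ne: "a \<noteq> ?r" "c \<noteq> ?s" using n fl by metis+
  have ac: "a \<noteq> c" using n t bet_identity by metis
  show ?thesis
  proof (cases "?r = ?s")
    case True
    let ?m = "perp_at l ?r"
    have m: "is_line ?m" using l fl is_line_perp_at by blast
    have "a \<in> ?m" "c \<in> ?m" using True unfolding perp_at_def by auto
    hence "t \<in> ?m" using line_bet m t ac by blast
    hence "t = ?r" using t l unfolding perp_at_def by simp
    hence "bet c ?r a" using t bet_sym by blast
    hence "out ?r c (psym ?r a)" using bet_out[of c ?r a "psym ?r a"] ne True by auto
    thus ?thesis using True by simp
  next
    case False
    have "le ?s c ?r a \<or> le ?r a ?s c" by (rule le_total)
    thus ?thesis
    proof
      assume "le ?s c ?r a"
      then obtain d where d: "bet ?r d a" "seg_cong ?s c ?r d" unfolding le_def by blast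
      obtain x where x: "bet t x ?r" "bet d x c" using inner_pasch[of c t a ?r d] t d bet_sym by blast
      have xl: "x \<in> l" using line_bet[of l t ?r x] l t fl x bet_identity by metis
      have dr: "d \<noteq> ?r" using d ne cong_eq_iff by metis
      have dl: "d \<notin> l" using ray_not_in_line[of l ?r a d] l fl n d dr ne unfolding out_def
        by blast
      have "foot l d = ?r" using line_bet[OF is_line_perp_at[of l ?r], of ?r a d] l fl d ne
        unfolding perp_at_def by auto
      hence cx: "c = psym x d"
        using equal_perpendiculars_cross[of l d ?r c ?s x] l dl False d xl x cong_sym by blast
      hence "?s = psym x ?r" using foot_psym[of l x d] l xl \<open>foot l d = ?r\<close> by simp
      hence m: "mid ?r ?s = x" "psym x ?r = ?s" by simp_all
      have "bet ?s c (psym x a)" using psym_preserves_bet[OF d(1), of x] cx m by simp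
      moreover have "psym x a \<noteq> ?s" using m ne by (metis psym_eq_iff)
      ultimately show ?thesis using m ne unfolding out_def by simp
    next
      assume "le ?r a ?s c"
      then obtain d where d: "bet ?s d c" "seg_cong ?r a ?s d" unfolding le_def by blast
      obtain x where x: "bet t x ?s" "bet d x a" using inner_pasch[of a t c ?s d] t d by blast
      have xl: "x \<in> l" using line_bet[of l t ?s x] l t fl x bet_identity by metis
      have dr: "d \<noteq> ?s" using d ne cong_eq_iff by metis
      have dl: "d \<notin> l" using ray_not_in_line[of l ?s c d] l fl n d dr ne unfolding out_def
        by blast
      have "foot l d = ?s" using line_bet[OF is_line_perp_at[of l ?s], of ?s c d] l fl d ne
        unfolding perp_at_def by auto
      hence cx: "d = psym x a"
        using equal_perpendiculars_cross[of l a ?r d ?s x] l n False d xl x bet_sym by blast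
      hence "?s = psym x ?r" using foot_psym[of l x a] l xl \<open>foot l d = ?s\<close> by simp
      hence m: "mid ?r ?s = x" "psym x ?r = ?s" by simp_all
      thus ?thesis using m d ne dr cx unfolding out_def by simp
    qed
  qed
qed

lemma out_imp_opp:
  assumes l: "is_line l" and a: "a \<notin> l" and o: "out (foot l c) c (psym (mid (foot l a) (foot l c)) a)"
  shows "opp l a c"
proof -
  let ?m = "mid (foot l a) (foot l c)"
  have m: "?m \<in> l" using l foot_in mid_in_line by blast
  have "psym ?m a \<notin> l" using opp_psym m a l unfolding opp_def by blast
  hence "opp l c (psym ?m (psym ?m a))"
    using opp_psym_ray[of l ?m "foot l c" "psym ?m a" c] l m foot_in o out_sym by blast
  thus ?thesis using opp_sym by simp
qed

text \<open>
  By \<open>opp_imp_out\<close> both \<open>c\<close> and the reflected point \<open>?c\<close> lie on the same ray, so that it suffices to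
  treat \<open>?c\<close> in place of \<open>c\<close>, where \<open>opp_psym_ray\<close> applies.
\<close>

lemma opp_ray:
  assumes l: "is_line l" and o: "opp l a c" and r: "r \<in> l" "out r a b"
  shows "opp l b c"
proof -
  let ?m = "mid (foot l a) (foot l c)"
  let ?c = "psym ?m a"
  have m: "?m \<in> l" using l foot_in mid_in_line by blast
  have a: "a \<notin> l" using o unfolding opp_def by blast
  have b: "b \<notin> l" using ray_not_in_line l a r by blast
  have f: "foot l ?c = foot l c" using foot_psym[of l ?m a] l m by simp
  have "out (foot l c) c ?c" using opp_imp_out l o by blast
  moreover have "opp l b ?c" using opp_psym_ray l m r a by blast
  hence "out (foot l c) ?c (psym (mid (foot l b) (foot l c)) b)" using opp_imp_out[of l b ?c] l f by simp
  ultimately show ?thesis using out_imp_opp[of l b c] l b out_trans by blast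
qed

text \<open>
  In the normal form of \<open>opp_imp_out\<close> both points are on the perpendicular through \<open>q\<close>, which has just two rays
  at its foot.
\<close>

lemma opp_dichotomy:
  assumes l: "is_line l" and n: "p \<notin> l" "q \<notin> l"
  shows "opp l p q \<or> opp l p (psym (foot l q) q)"
proof -
  let ?s = "foot l q"
  let ?m = "mid (foot l p) ?s"
  let ?p = "psym ?m p"
  have m: "?m \<in> l" "?s \<in> l" using l foot_in mid_in_line by blast+
  have f: "foot l ?p = ?s" using foot_psym[of l ?m p] l m by simp
  have ne: "q \<noteq> ?s" using n m by metis
  have pn: "?p \<noteq> ?s" using n m l f line_psym[of l ?m ?p] by (metis psym_psym)
  have "col ?s q ?p" using line_col[OF is_line_perp_at[of l ?s], of ?s q ?p] l m f ne
    unfolding perp_at_def by auto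
  hence "out ?s q ?p \<or> bet q ?s ?p" using ne pn bet_sym unfolding col_def out_def by blast
  thus ?thesis
  proof
    assume "out ?s q ?p"
    thus ?thesis using out_imp_opp l n by blast
  next
    assume "bet q ?s ?p"
    hence "out ?s (psym ?s q) ?p" using bet_out[of "psym ?s q" ?s q ?p] ne pn bet_sym by auto
    moreover have "foot l (psym ?s q) = ?s" using foot_psym[of l ?s q] l m by simp
    ultimately show ?thesis using out_imp_opp[of l p "psym ?s q"] l n by simp
  qed
qed

text \<open>
  The segments from \<open>d\<close> to \<open>a\<close> and \<open>b\<close> cross \<open>l\<close> at \<open>t\<close> and \<open>z\<close>. Pasch's axiom gives a point \<open>x\<close> on the
  segments \<open>za\<close> and \<open>tb\<close>; moving from \<open>a\<close> to \<open>x\<close> along a ray from \<open>z\<close> and from \<open>x\<close> to \<open>b\<close> along a ray from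
  \<open>t\<close> does not change the side.
\<close>

lemma opp_same_side:
  assumes l: "is_line l" and ac: "opp l a c" and ad: "opp l a d" and bd: "opp l b d"
  shows "opp l b c"
proof -
  obtain t where t: "t \<in> l" "bet a t d" using ad unfolding opp_def by blast
  obtain z where z: "z \<in> l" "bet b z d" using bd unfolding opp_def by blast
  have n: "a \<notin> l" "b \<notin> l" "c \<notin> l" "d \<notin> l" using assms unfolding opp_def
    by auto
  obtain x where x: "bet t x b" "bet z x a" using inner_pasch[of a t d b z] t z by blast
  show ?thesis
  proof (cases "x \<in> l")
    case False
    have "out z a x" using False n z x unfolding out_def by blast
    hence xc: "opp l x c" using opp_ray l ac z by blast
    have "out t x b" using False n t x unfolding out_def by blast
    thus ?thesis using opp_ray l xc t by blast
  next
    case True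
    have "x = t" using line_bet[of l x t b] l True t(1) bet_sym[OF x(1)] n(2) by metis
    moreover have "x = z" using line_bet[of l x z a] l True z(1) bet_sym[OF x(2)] n(1) by metis
    ultimately have "out t a b" using bet_out[of a t d b] t z n by blast
    thus ?thesis using opp_ray l ac t by blast
  qed
qed

lemma not_all_opp: "is_line l \<Longrightarrow> opp l a b \<Longrightarrow> opp l b c \<Longrightarrow> opp l a c \<Longrightarrow> False"
proof -
  assume "is_line l" "opp l a b" "opp l b c" "opp l a c"
  hence "opp l c c" using opp_same_side[of l a c b c] opp_sym by blast
  thus False unfolding opp_def using bet_identity by metis
qed

text \<open>
  Pasch's axiom in Hilbert's form. If neither segment crosses \<open>l\<close>, then \<open>a\<close> and \<open>c\<close> are both opposite to
  the mirror image of \<open>b\<close>, and three points cannot be pairwise opposite.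
\<close>

lemma plane_separation:
  assumes l: "is_line l" and "opp l a c" "b \<notin> l" shows "opp l a b \<or> opp l b c"
proof (rule ccontr)
  assume n: "\<not> ?thesis"
  have "a \<notin> l" "c \<notin> l" using assms unfolding opp_def by auto
  hence "opp l a (psym (foot l b) b)" "opp l c (psym (foot l b) b)"
    using opp_dichotomy[OF l] n assms opp_sym by blast+
  thus False using not_all_opp[OF l] assms opp_sym by blast
qed

section \<open>Parallel lines\<close>

text \<open>
  Let \<open>m\<close> and \<open>n\<close> be different. A point \<open>t\<close> of \<open>l\<close> lies inside one of the angles that they form at \<open>p\<close>, and
  the axiom \<open>euclid\<close> draws through \<open>t\<close> a segment \<open>xy\<close> with ends on the two legs. Its ends are on
  different sides of \<open>l\<close>, so one of the legs crosses \<open>l\<close>.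
\<close>

lemma playfair:
  assumes l: "is_line l" and m: "is_line m" "p \<in> m" "m \<inter> l = {}" and n: "is_line n" "p \<in> n" "n \<inter> l = {}"
  shows "m = n"
proof (rule ccontr)
  assume mn: "m \<noteq> n"
  have mi: "x = p" if "x \<in> m" "x \<in> n" for x using that m n mn line_eq_line by blast
  obtain t where t: "t \<in> l" using l line_ex_two by blast
  have tn: "t \<notin> m" "t \<notin> n" using t m n by blast+
  obtain b0 where b0: "b0 \<noteq> p" "b0 \<in> m" using line_ex_other m by blast
  have b0n: "b0 \<notin> n" using b0 mi by blast
  \<comment> \<open>One of the two rays of \<open>m\<close> at \<open>p\<close> is on the other side of \<open>n\<close> than \<open>t\<close>; the opposite ray and \<open>pc\<close> below enclose \<open>t\<close>.\<close>
  have "\<exists>b\<in>m. opp n b t"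
  proof (cases "opp n b0 t")
    case True thus ?thesis using b0 by blast
  next
    case False
    have "opp n b0 (psym p b0)" using opp_psym n b0n by blast
    hence "opp n t (psym p b0)" using plane_separation[OF n(1), of b0 "psym p b0" t] False tn opp_sym
      by blast
    thus ?thesis using line_psym[of m p b0] m b0 opp_sym by blast
  qed
  then obtain b where b: "b \<in> m" "opp n b t" by blast
  obtain c where c: "c \<in> n" "bet b c t" using b unfolding opp_def by blast
  have bn: "b \<notin> n" using b unfolding opp_def by blast
  let ?b = "psym p b"
  obtain d where d: "bet p d t" "bet c d ?b" using inner_pasch[of ?b p b t c] c bet_sym by auto
  have bp: "b \<noteq> p" using bn n by blast
  have b'm: "?b \<in> m" using line_psym m b by blast
  have cm: "c \<notin> m" using c b m(1) tn line_bet[of m b c t] bn by metis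
  have dp: "p \<noteq> d"
  proof
    assume "p = d"
    hence "c \<in> m" using line_bet[of m ?b p c] d b'm m bp bet_sym by auto
    thus False using cm by simp
  qed
  obtain x y where xy: "bet p ?b x" "bet p c y" "bet x t y" using euclid[of p d t ?b c] d dp bet_sym
    by blast
  have "p \<noteq> ?b" using bp by (metis psym_fixed_iff psym_psym)
  hence x: "x \<in> m" using line_bet[of m p ?b x] m b'm xy by blast
  have "p \<noteq> c" using cm m by blast
  hence y: "y \<in> n" using line_bet[of n p c y] n c xy by blast
  have nl: "p \<notin> l" "x \<notin> l" "y \<notin> l" using x y m n by blast+
  have "opp l x y" using nl xy t unfolding opp_def by blast
  hence "opp l x p \<or> opp l p y" using plane_separation l nl by blast
  thus False
  proof
    assume "opp l x p"
    then obtain s where "s \<in> l" "bet x s p" unfolding opp_def by blast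
    hence "s \<in> m" using line_bet[of m x p s] x m bet_identity by metis
    thus False using \<open>s \<in> l\<close> m by blast
  next
    assume "opp l p y"
    then obtain s where "s \<in> l" "bet p s y" unfolding opp_def by blast
    hence "s \<in> n" using line_bet[of n p y s] y n bet_identity by metis
    thus False using \<open>s \<in> l\<close> n by blast
  qed
qed

lemma perp_at_disjoint: "p \<noteq> q \<Longrightarrow> perp_at l p \<inter> perp_at l q = {}"
  unfolding perp_at_def by blast

lemma perp_at_eqI:
  assumes "is_line l" "p \<in> l" "x \<in> l" "x \<noteq> p" "per x p y" "y \<noteq> p" shows "perp_at l p = line p y"
proof -
  have "y \<in> perp_at l p" using assms foot_unique unfolding perp_at_def by blast
  thus ?thesis using line_eq[of "perp_at l p" p y] is_line_perp_at assms by simp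
qed

text \<open>
  The line \<open>ba\<close> and the perpendicular of \<open>da\<close> at \<open>a\<close> both pass through \<open>a\<close> and do not meet \<open>cd\<close>, since they
  have a common perpendicular with it. So they are the same line.
\<close>

lemma lambert:
  assumes ne: "a \<noteq> b" "b \<noteq> c" "c \<noteq> d" "d \<noteq> a" and "per a b c" "per b c d" "per c d a"
  shows "per d a b"
proof -
  let ?bc = "line b c" and ?da = "line d a"
  have ab: "perp_at ?bc b = line b a" using perp_at_eqI[of ?bc b c a] ne assms per_sym by simp
  have cd: "perp_at ?bc c = line c d" using perp_at_eqI[of ?bc c b d] ne assms by simp
  have dc: "perp_at ?da d = line d c" using perp_at_eqI[of ?da d a c] ne assms per_sym by simp
  have "line c d \<inter> line b a = {}" using ab cd perp_at_disjoint[of c b ?bc] ne by simp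
  moreover have "perp_at ?da a \<inter> perp_at ?da d = {}" using perp_at_disjoint ne by simp
  ultimately have "line b a = perp_at ?da a"
    using playfair[of "line c d" "line b a" a "perp_at ?da a"] dc ne is_line_perp_at[of ?da a] line_commute[of c d] by auto
  hence "foot ?da b = a" unfolding perp_at_def using line_contains(1)[of b a] by blast
  thus ?thesis using foot_per[of ?da d b] ne by simp
qed

text \<open>
  A point of \<open>l\<close> with image in \<open>l\<close> would put the centre on \<open>l\<close>.
\<close>

lemma psym_line_disjoint:
  assumes l: "is_line l" and m: "m \<notin> l" shows "psym m ` l \<inter> l = {}"
proof -
  have False if x: "x \<in> l" "psym m x \<in> l" for x
  proof -
    have "x \<noteq> psym m x" using x m by (metis psym_fixed_iff)
    thus False using line_bet[of l x "psym m x" m] x m l by auto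
  qed
  thus ?thesis by auto
qed

lemma is_line_psym: "is_line l \<Longrightarrow> is_line (psym m ` l)"
proof -
  assume "is_line l"
  then obtain a b where ab: "a \<noteq> b" "l = line a b" unfolding is_line_def by blast
  have "psym m ` line a b = line (psym m a) (psym m b)"
  proof (intro set_eqI iffI)
    fix x assume "x \<in> psym m ` line a b"
    thus "x \<in> line (psym m a) (psym m b)" unfolding line_def using psym_preserves_col by auto
  next
    fix x assume "x \<in> line (psym m a) (psym m b)"
    hence "psym m x \<in> line a b" unfolding line_def
      using psym_preserves_col[of "psym m a" "psym m b" x m] by simp
    thus "x \<in> psym m ` line a b" by (metis imageI psym_psym)
  qed
  thus ?thesis using ab by simp
qed

section \<open>Isometries and line reflections\<close>

definition isom :: "('a \<Rightarrow> 'a) \<Rightarrow> bool" where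
  "isom f \<longleftrightarrow> (\<forall>p q. seg_cong (f p) (f q) p q)"

lemma isomD: "isom f \<Longrightarrow> seg_cong (f p) (f q) p q"
  unfolding isom_def by blast

lemma isom_inj: "isom f \<Longrightarrow> f p = f q \<longleftrightarrow> p = q"
  using isomD cong_eq_iff by metis

lemma isom_comp: "isom f \<Longrightarrow> isom g \<Longrightarrow> isom (\<lambda>p. f (g p))"
  unfolding isom_def using cong_trans by blast

lemma isom_bet: "isom f \<Longrightarrow> bet a b c \<Longrightarrow> bet (f a) (f b) (f c)"
  using cong3_bet[of a b c "f a" "f b" "f c"] isomD cong_sym unfolding cong3_def by metis

lemma isom_col: "isom f \<Longrightarrow> col a b c \<Longrightarrow> col (f a) (f b) (f c)"
  using isom_bet unfolding col_def by blast

lemma isom_psym: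
  assumes "isom f" shows "f (psym m a) = psym (f m) (f a)"
proof -
  have "seg_cong (f a) (f m) (f m) (f (psym m a))"
    using isomD[OF assms] psym_center by (metis cong_inner_trans midpoint_def midpoint_psym)
  hence "midpoint (f m) (f a) (f (psym m a))"
    using isom_bet[OF assms psym_bet(1)] unfolding midpoint_def by blast
  thus ?thesis using midpoint_iff by blast
qed

lemma isom_mid: "isom f \<Longrightarrow> f (mid a b) = mid (f a) (f b)"
  using isom_psym[of f "mid a b" a] mid_psym[of "f a" "f (mid a b)"] by simp

lemma isom_per: "isom f \<Longrightarrow> per a b c \<Longrightarrow> per (f a) (f b) (f c)"
  unfolding per_def using isom_psym[of f b c] isomD[of f a c] isomD[of f a "psym b c"] using cong_len
  by force

text \<open>
  Stated with an inclusion instead of an image, because it is applied to lines that are only known to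
  be mapped into each other.
\<close>

lemma isom_foot:
  assumes f: "isom f" and l: "is_line l" "is_line m" "\<And>x. x \<in> l \<Longrightarrow> f x \<in> m"
  shows "foot m (f p) = f (foot l p)"
proof -
  obtain x where x: "x \<noteq> foot l p" "x \<in> l" using line_ex_other[OF l(1), of "foot l p"]
    by metis
  have "per (f x) (f (foot l p)) (f p)" using isom_per[OF f foot_per[OF l(1) x(2)]] .
  moreover have "f x \<noteq> f (foot l p)" using isom_inj[OF f] x by simp
  ultimately show ?thesis using foot_unique[OF l(2) l(3)[OF foot_in[OF l(1)]] l(3)[OF x(2)]] by blast
qed

lemma isom_psym_fun: "isom (psym m)"
  unfolding isom_def by simp

lemma psym_conj: "psym m (psym b c) = psym (psym m b) (psym m c)"
  using isom_psym[OF isom_psym_fun] .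

definition mirror :: "'a set \<Rightarrow> 'a \<Rightarrow> 'a" where
  "mirror l p = psym (foot l p) p"

lemma foot_mirror [simp]: "is_line l \<Longrightarrow> foot l (mirror l p) = foot l p"
  unfolding mirror_def using foot_psym[of l "foot l p" p] foot_in by simp

lemma mirror_mirror [simp]: "is_line l \<Longrightarrow> mirror l (mirror l p) = p"
  using foot_mirror[of l p] unfolding mirror_def by simp

lemma mirror_fixed_iff: "is_line l \<Longrightarrow> mirror l p = p \<longleftrightarrow> p \<in> l"
  unfolding mirror_def using foot_eq_iff by (metis psym_fixed_iff)

lemma mirror_on_line [simp]: "is_line l \<Longrightarrow> p \<in> l \<Longrightarrow> mirror l p = p"
  using mirror_fixed_iff by blast

lemma cong_double:
  assumes "seg_cong m a n b" shows "seg_cong a (psym m a) b (psym n b)"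
proof -
  have "seg_cong m (psym m a) n (psym n b)" using assms psym_center by (meson cong_trans)
  thus ?thesis using five_segment_add[of a m "psym m a" b n "psym n b"] assms cong_left cong_right psym_bet(1) by blast
qed

text \<open>
  The midpoint of one segment is transferred to the other, where midpoints are unique.
\<close>

lemma cong_halve:
  assumes "seg_cong a (psym m a) b (psym n b)" shows "seg_cong m a n b"
proof -
  obtain k where k: "bet b k (psym n b)" "cong3 a m (psym m a) b k (psym n b)"
    using ex_transfer_between[of a m "psym m a" b "psym n b"] assms by auto
  have "seg_cong b k k (psym n b)" using k psym_center[of m a] unfolding cong3_def
    by (metis cong_len cong_swap)
  hence "midpoint k b (psym n b)" using k unfolding midpoint_def by blast
  hence "k = n" using midpoint_unique midpoint_psym by blast
  thus ?thesis using k unfolding cong3_def using cong_left cong_right by blast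
qed

text \<open>
  For different feet, a point reflection \<open>psym ?m\<close> carries the perpendicular through \<open>p\<close> to the one
  through \<open>q\<close>. On that line the mirror image of a point is its reflection in the foot of \<open>q\<close>, and
  \<open>col_five_segment\<close> extends the congruence to \<open>p\<close>.
\<close>

lemma isom_mirror:
  assumes l: "is_line l" shows "isom (mirror l)"
proof -
  have "seg_cong (mirror l q) (mirror l p) q p" for p q
  proof -
    let ?p = "foot l p" and ?q = "foot l q"
    have fl: "?p \<in> l" "?q \<in> l" using l foot_in by auto
    \<comment> \<open>If \<open>p\<close> is on \<open>l\<close>, the point \<open>?r\<close> below coincides with \<open>?q\<close> and spans no line with it.\<close>
    consider "?p = ?q" | "p = ?p" "?p \<noteq> ?q" | "p \<noteq> ?p" "?p \<noteq> ?q" by blast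
    thus ?thesis
    proof cases
      case 1 thus ?thesis unfolding mirror_def by simp
    next
      case 2
      hence "p \<in> l" using fl by metis
      hence "mirror l p = p" using l foot_self unfolding mirror_def by simp
      have "seg_cong p q p (mirror l q)" using foot_per[OF l \<open>p \<in> l\<close>, of q]
        unfolding per_def mirror_def .
      thus ?thesis using \<open>mirror l p = p\<close> by (metis cong_left cong_right cong_sym)
    next
      case 3
      let ?m = "mid ?p ?q"
      let ?r = "psym ?m p" and ?r' = "psym ?m (mirror l p)"
      have ml: "?m \<in> l" using mid_in_line l fl by blast
      have fr: "foot l ?r = ?q" using foot_psym[OF l ml, of p] by simp
      have r': "?r' = psym ?q ?r" unfolding mirror_def using psym_conj[of ?m ?p p] by simp
      have rq: "?r \<noteq> ?q" using 3 by (metis psym_mid(1) psym_eq_iff)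
      have "?r \<in> perp_at l ?q" "q \<in> perp_at l ?q" using fr unfolding perp_at_def by auto
      hence c: "col ?q ?r q"
        using line_col[OF is_line_perp_at[OF l fl(2)] perp_at_contains[OF l fl(2)], of ?r q] rq by metis
      have "cong3 ?q ?r q ?q ?r' (mirror l q)"
        unfolding cong3_def r' mirror_def[of l q] by (simp add: cong_sym)
      moreover have "seg_cong ?q p ?q (mirror l p)" using foot_per[OF l fl(2), of p]
        unfolding per_def mirror_def .
      moreover have "seg_cong ?m p ?m (mirror l p)" using foot_per[OF l ml, of p]
        unfolding per_def mirror_def .
      hence "seg_cong ?r p ?r' (mirror l p)" using cong_double cong_left cong_right by blast
      ultimately have "seg_cong q p (mirror l q) (mirror l p)" using col_five_segment[OF c] rq by metis
      thus ?thesis by (rule cong_sym)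
    qed
  qed
  thus ?thesis unfolding isom_def by blast
qed

text \<open>
  A point and its image are equidistant from \<open>a\<close> and \<open>b\<close>. If moreover a point off the line is fixed, then
  every point is, since three points equidistant from two different points are collinear.
\<close>

lemma isom_fixing_two:
  assumes f: "isom f" "f a = a" "f b = b" and ab: "a \<noteq> b"
  shows "(\<forall>p. f p = p) \<or> (\<forall>p. f p = mirror (line a b) p)"
proof (cases "\<exists>p. p \<notin> line a b \<and> f p = p")
  case True
  then obtain p where p: "p \<notin> line a b" "f p = p" by blast
  have "f q = q" for q
  proof (rule ccontr)
    assume n: "f q \<noteq> q"
    have "seg_cong a q a (f q)" "seg_cong b q b (f q)" "seg_cong p q p (f q)"
      using isomD[OF f(1)] f p cong_sym by metis+
    hence "col a b p" using upper_dim[of q "f q" a b p] n unfolding col_def by metis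
    thus False using p unfolding line_def by simp
  qed
  thus ?thesis by blast
next
  case False
  have "f p = mirror (line a b) p" for p
  proof (cases "p \<in> line a b")
    case True
    have "seg_cong a p a (f p)" "seg_cong b p b (f p)" using isomD[OF f(1)] f cong_sym by metis+
    hence "p = f p" using col_point_unique[of a b p "f p"] ab True unfolding line_def by simp
    thus ?thesis using True ab by simp
  next
    case n: False
    have "seg_cong a p a (f p)" "seg_cong b p b (f p)" using isomD[OF f(1)] f cong_sym by metis+
    moreover have "p \<noteq> f p" using False n by metis
    ultimately show ?thesis using reflection_unique[of "line a b" a b p "f p"] ab unfolding mirror_def
      by simp
  qed
  thus ?thesis by blast
qed

text \<open>
  For \<open>p \<noteq> q\<close> the axis is the perpendicular bisector of \<open>pq\<close>; the cases distinguish whether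
  it can be described as the line joining \<open>o'\<close> with the midpoint.
\<close>

lemma ex_mirror_swap:
  assumes "seg_cong o' p o' q" "p \<noteq> o'" shows "\<exists>l. is_line l \<and> o' \<in> l \<and> mirror l p = q"
proof -
  consider "p = q" | "p \<noteq> q" "mid p q \<noteq> o'" | "p \<noteq> q" "mid p q = o'" by blast
  thus ?thesis
  proof cases
    case 1
    thus ?thesis using assms by (intro exI[of _ "line o' p"]) simp
  next
    case 2
    let ?m = "mid p q"
    have "per o' ?m p" using assms unfolding per_def by simp
    hence "foot (line o' ?m) p = ?m" using foot_unique[of "line o' ?m" ?m o' p] 2 by simp
    thus ?thesis using 2 unfolding mirror_def by (intro exI[of _ "line o' ?m"]) simp
  next
    case 3
    let ?n = "line o' p"
    let ?l = "perp_at ?n o'"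
    have n: "is_line ?n" "o' \<in> ?n" "p \<in> ?n" using assms by auto
    have l: "is_line ?l" "o' \<in> ?l" using is_line_perp_at n perp_at_contains by blast+
    obtain x where x: "x \<noteq> o'" "x \<in> ?l" using line_ex_other[OF l(1), of o'] by metis
    have "foot ?n x = o'" using x unfolding perp_at_def by simp
    hence "per x o' p" using foot_per[OF n(1,3), of x] per_sym by simp
    hence "foot ?l p = o'" using foot_unique[OF l x(2) x(1)] by blast
    moreover have "psym o' p = q" using 3 psym_mid by metis
    ultimately show ?thesis using l unfolding mirror_def by (intro exI[of _ ?l]) simp
  qed
qed

text \<open>
  Both lines are the perpendicular of \<open>mq\<close> at \<open>m\<close>.
\<close>

lemma line_eq_if_same_foot:
  assumes a: "is_line a" and b: "is_line b" and "foot a q = m" "foot b q = m" "q \<noteq> m" shows "a = b"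
proof -
  let ?n = "line m q"
  have n: "is_line ?n" using assms by simp
  have "c = perp_at ?n m" if c: "is_line c" "foot c q = m" for c
  proof -
    have m: "m \<in> c" using c foot_in by blast
    obtain x where x: "x \<noteq> m" "x \<in> c" using line_ex_other[OF c(1), of m] by metis
    have "per q m x" using foot_per[OF c(1) x(2), of q] c(2) per_sym by simp
    hence "x \<in> perp_at ?n m" using foot_unique[of ?n m q x] n assms(5) unfolding perp_at_def by simp
    moreover have "is_line (perp_at ?n m)" "m \<in> perp_at ?n m" using is_line_perp_at n by auto
    ultimately show ?thesis using line_eq_line[of c "perp_at ?n m" x m] c m x by blast
  qed
  thus ?thesis using assms by metis
qed

text \<open>
  Let \<open>d\<close> be the line whose reflection agrees with the product \<open>?g\<close> at one point \<open>r\<close> of \<open>c\<close>. The product of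
  both fixes \<open>c\<close> pointwise, hence is the identity or the reflection in \<open>c\<close>. In the first case \<open>?g\<close> is the
  reflection in \<open>d\<close>. The second case would make the product of the reflections in \<open>a\<close> and \<open>b\<close> a reflection,
  which is impossible for \<open>a \<noteq> b\<close>.
\<close>

lemma three_reflections:
  assumes a: "is_line a" "o' \<in> a" and b: "is_line b" "o' \<in> b" and c: "is_line c" "o' \<in> c"
  shows "mirror a (mirror b (mirror c (mirror a (mirror b (mirror c p))))) = p"
proof (cases "a = b")
  case True thus ?thesis using a c by simp
next
  case False
  let ?g = "\<lambda>x. mirror a (mirror b (mirror c x))"
  have g: "isom ?g" using isom_comp[OF isom_mirror[OF a(1)] isom_comp[OF isom_mirror[OF b(1)] isom_mirror[OF c(1)]]] .
  obtain r where r: "r \<noteq> o'" "r \<in> c" using line_ex_other[OF c(1), of o'] by metis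
  have go: "?g o' = o'" using a b c by simp
  hence "seg_cong o' r o' (?g r)" using isomD[OF g, of o' r] cong_sym by simp
  then obtain d where d: "is_line d" "o' \<in> d" "mirror d r = ?g r" using ex_mirror_swap r by blast
  let ?h = "\<lambda>x. mirror d (?g x)"
  have h: "isom ?h" using isom_comp[OF isom_mirror[OF d(1)] g] .
  have "?h o' = o'" using go d by simp
  moreover have "?h r = r" using d by (metis mirror_mirror)
  moreover have "line o' r = c" using line_eq[OF c r(2)] r by metis
  ultimately have "(\<forall>x. ?h x = x) \<or> (\<forall>x. ?h x = mirror c x)"
    using isom_fixing_two[OF h, of o' r] r by metis
  thus ?thesis
  proof
    assume "\<forall>x. ?h x = x"
    hence "?g x = mirror d x" for x using d by (metis mirror_mirror)
    thus ?thesis using d by (metis mirror_mirror)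
  next
    assume *: "\<forall>x. ?h x = mirror c x"
    have ab: "mirror a (mirror b y) = mirror d y" for y
      using *[rule_format, of "mirror c y"] c(1) d(1) by (metis mirror_mirror)
    obtain q where q: "q \<noteq> o'" "q \<in> d" using line_ex_other[OF d(1), of o'] by metis
    have "mirror a (mirror b q) = q" using ab q d by simp
    hence e: "mirror b q = mirror a q" using a by (metis mirror_mirror)
    have False
    proof (cases "mirror a q = q")
      case True
      hence "q \<in> a" "q \<in> b" using e a b mirror_fixed_iff by auto
      thus False using line_eq_line[of a b q o'] a b q False by blast
    next
      case n: False
      have "foot a q = foot b q" using e unfolding mirror_def using mid_psym by metis
      moreover have "q \<noteq> foot a q" using n unfolding mirror_def by auto
      ultimately show False using line_eq_if_same_foot[OF a(1) b(1), of q] False by metis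
    qed
    thus ?thesis ..
  qed
qed

section \<open>Rectangles\<close>

lemma right_angle_iff: "right_angle a b c \<longleftrightarrow> a \<noteq> b \<and> b \<noteq> c \<and> per a b c"
proof
  assume "right_angle a b c"
  then obtain x where x: "b \<noteq> c" "sbet a b x" "seg_cong a b x b" "seg_cong a c x c"
    unfolding right_angle_def by blast
  have "midpoint b a x" using x unfolding sbet_def midpoint_def by (meson cong_right)
  hence "x = psym b a" using midpoint_iff by blast
  hence "per c b a" using x unfolding per_def by (meson cong_left cong_right)
  thus "a \<noteq> b \<and> b \<noteq> c \<and> per a b c" using x per_sym unfolding sbet_def by blast
next
  assume *: "a \<noteq> b \<and> b \<noteq> c \<and> per a b c"
  hence "per c b a" using per_sym by blast
  hence "seg_cong a c (psym b a) c" unfolding per_def by (meson cong_left cong_right)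
  moreover have "sbet a b (psym b a)" using * unfolding sbet_def
    by (metis psym_bet(1) psym_fixed_iff psym_psym)
  moreover have "seg_cong a b (psym b a) b" using psym_center[of b a] by (meson cong_left cong_right)
  ultimately show "right_angle a b c" using * unfolding right_angle_def by blast
qed

lemma rectangle_iff: "rectangle a b c d \<longleftrightarrow>
   a \<noteq> b \<and> b \<noteq> c \<and> c \<noteq> d \<and> d \<noteq> a \<and> per a b c \<and> per b c d \<and> per c d a \<and> per d a b"
  unfolding rectangle_def right_angle_iff by auto

lemma rectangle_rotate: "rectangle a b c d \<Longrightarrow> rectangle b c d a"
  unfolding rectangle_iff by auto

lemma rectangle_reverse: "rectangle a b c d \<Longrightarrow> rectangle b a d c"
  unfolding rectangle_iff using per_sym by auto

lemma rectangle_lines: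
  assumes "rectangle a b c d"
  shows "perp_at (line b c) b = line b a" "perp_at (line b c) c = line c d"
  using assms perp_at_eqI[of "line b c" b c a] perp_at_eqI[of "line b c" c b d] per_sym
  unfolding rectangle_iff by auto

text \<open>
  Opposite sides have the common perpendicular \<open>bc\<close>.
\<close>

lemma rectangle_disjoint: "rectangle a b c d \<Longrightarrow> line b a \<inter> line c d = {}"
  using rectangle_lines perp_at_disjoint[of b c "line b c"] unfolding rectangle_iff by metis

text \<open>
  The point reflection in the midpoint of the diagonal \<open>ac\<close> maps the line of each side to a line through
  a vertex that does not meet that side, which by \<open>playfair\<close> is the line of the opposite side.
\<close>

lemma rectangle_psym:
  assumes r: "rectangle a b c d" shows "psym (mid a c) b = d"
proof -
  let ?m = "mid a c"
  have *: "psym (mid x z) y \<in> line z w" if q: "rectangle x y z w" for x y z w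
  proof -
    let ?l = "line y x"
    have l: "is_line ?l" "is_line (line z w)" using q unfolding rectangle_iff by auto
    have d: "line y x \<inter> line z w = {}" using rectangle_disjoint[OF q] .
    have "mid x z \<notin> ?l"
    proof
      assume "mid x z \<in> ?l"
      hence "z \<in> ?l" using line_psym[OF l(1), of "mid x z" x] by simp
      thus False using d line_contains(1)[of z w] by blast
    qed
    hence "psym (mid x z) ` ?l \<inter> ?l = {}" using psym_line_disjoint[OF l(1)] by blast
    moreover have "z \<in> psym (mid x z) ` ?l" using psym_mid(1)[of x z] line_contains(2)[of x y]
      by (metis imageI)
    moreover have "is_line (psym (mid x z) ` ?l)" using is_line_psym[OF l(1)] .
    ultimately have "psym (mid x z) ` ?l = line z w"
      using playfair[OF l(1), of "psym (mid x z) ` ?l" z "line z w"] l(2) d by auto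
    thus ?thesis by (metis imageI line_contains(1))
  qed
  have 1: "psym ?m b \<in> line c d" using *[OF r] .
  have r': "rectangle c b a d" using r per_sym unfolding rectangle_iff by auto
  have 2: "psym ?m b \<in> line a d" using *[OF r'] mid_commute[of a c] by simp
  have "a \<notin> line c d" using rectangle_disjoint[OF r] line_contains(2)[of a b] by blast
  hence "line c d \<noteq> line a d" using line_contains(1)[of a d] by metis
  moreover have "is_line (line c d)" "is_line (line a d)" using r unfolding rectangle_iff by auto
  ultimately show ?thesis using line_eq_line[of "line c d" "line a d" "psym ?m b" d] 1 2 line_contains(2) by metis
qed

lemma rectangle_opposite_sides:
  assumes r: "rectangle a b c d" shows "seg_cong a b c d" "seg_cong b c d a"
proof -
  have "psym (mid a c) a = c" "psym (mid a c) b = d" "psym (mid a c) c = a" using rectangle_psym[OF r]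
    by auto
  thus "seg_cong a b c d" "seg_cong b c d a"
    using psym_isometry[of "mid a c" a b] psym_isometry[of "mid a c" b c] cong_sym by metis+
qed

text \<open>
  The fourth vertex is the foot of \<open>a\<close> on the perpendicular of \<open>bc\<close> at \<open>c\<close>, and Lambert's quadrilateral
  provides the fourth right angle.
\<close>

lemma ex_fourth_vertex:
  assumes "a \<noteq> b" "b \<noteq> c" "per a b c" shows "\<exists>d. rectangle a b c d"
proof -
  let ?l = "line b c"
  let ?n = "perp_at ?l c"
  let ?d = "foot ?n a"
  have l: "is_line ?l" "b \<in> ?l" "c \<in> ?l" using assms by auto
  have n: "is_line ?n" "c \<in> ?n" using is_line_perp_at l by auto
  have a: "foot ?l a = b" using foot_unique[OF l(1,2,3)] assms per_sym by metis
  have d: "?d \<in> ?n" using foot_in n by blast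
  hence fd: "foot ?l ?d = c" unfolding perp_at_def by simp
  have p1: "per b c ?d" using foot_per[OF l(1,2), of ?d] fd by simp
  have p2: "per c ?d a" using foot_per[OF n, of a] .
  have da: "?d \<noteq> a" using fd a assms(2) by metis
  have dc: "?d \<noteq> c"
  proof
    assume *: "?d = c"
    obtain x where x: "x \<noteq> c" "x \<in> ?n" using line_ex_other[OF n(1), of c] by metis
    have "per x c a" using foot_per[OF n(1) x(2), of a] * by simp
    moreover have "per x c b" using foot_per[OF l(1,2), of x] x(2) per_sym unfolding perp_at_def by auto
    ultimately have "a \<in> perp_at ?n c" "b \<in> perp_at ?n c" "c \<in> perp_at ?n c"
      using foot_unique[OF n x(2,1)] n unfolding perp_at_def by auto
    hence "perp_at ?n c = ?l" using line_eq[of "perp_at ?n c" b c] is_line_perp_at[OF n] assms by blast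
    hence "a \<in> ?l" using \<open>a \<in> perp_at ?n c\<close> by simp
    thus False using a l assms by simp
  qed
  have "per ?d a b" using lambert[of a b c ?d] assms da dc p1 p2 by metis
  hence "rectangle a b c ?d" using assms da dc p1 p2 unfolding rectangle_iff by metis
  thus ?thesis by blast
qed

section \<open>Orthogonal projection\<close>

text \<open>
  For points on the same side of \<open>l\<close>: the diagonals of a rectangle are congruent. The reflection in the
  midpoint of \<open>x\<close> and \<open>w\<close> carries \<open>y\<close> to the perpendicular through \<open>z\<close>, either to \<open>z\<close> or to its
  mirror image, and both have the same distance from \<open>x\<close>.
\<close>

lemma equal_heights:
  assumes l: "is_line l" "x \<in> l" "w \<in> l" and y: "foot l y = x" and z: "foot l z = w" and c: "seg_cong x y w z"
  shows "seg_cong w y x z"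
proof (cases "x = y")
  case True
  hence "w = z" using c cong_eq_iff by blast
  thus ?thesis using True by simp
next
  case False
  let ?n = "mid x w"
  let ?y = "psym ?n y"
  have nl: "?n \<in> l" using mid_in_line l by blast
  have fy: "foot l ?y = w" using foot_psym[OF l(1) nl, of y] y by simp
  have wz: "w \<noteq> z" using False c cong_eq_iff by blast
  have wy: "seg_cong w ?y w z"
    using psym_isometry[of ?n x y] c by (metis psym_mid(1) cong_trans)
  have "?y \<in> perp_at l w" "z \<in> perp_at l w" "w \<in> perp_at l w" using fy z l
    unfolding perp_at_def by auto
  hence col: "col ?y w z"
    using line_col[OF is_line_perp_at[OF l(1,3)], of w z ?y] wz col_perm by metis
  have "seg_cong x ?y x z"
  proof (cases "?y = z")
    case True thus ?thesis by simp
  next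
    case n: False
    have "midpoint w ?y z" using col_equidistant_midpoint[OF col wy n] .
    hence "z = psym w ?y" using midpoint_iff by blast
    moreover have "per x w ?y" using foot_per[OF l(1,2), of ?y] fy by simp
    ultimately show ?thesis unfolding per_def by simp
  qed
  moreover have "seg_cong x ?y w y" using psym_isometry[of ?n w y] by simp
  ultimately show ?thesis using cong_trans cong_sym by blast
qed

text \<open>
  Reflecting the foot of \<open>w\<close> in the midpoint \<open>?m\<close> gives by \<open>playfair\<close> a point \<open>?y\<close> on the perpendicular
  through \<open>x\<close>. The segments from the feet to \<open>?y\<close> and \<open>?z\<close> are the congruent diagonals of a rectangle
  with centre \<open>?m\<close>; thus \<open>?m\<close> is equidistant from the two feet and projects to their midpoint.
\<close>

lemma foot_mid:
  assumes l: "is_line l" shows "foot l (mid w x) = mid (foot l w) (foot l x)"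
proof -
  let ?w = "foot l w" and ?x = "foot l x" and ?m = "mid w x"
  have fl: "?w \<in> l" "?x \<in> l" using foot_in l by auto
  show ?thesis
  proof (cases "?w = ?x")
    case True
    have "w \<in> perp_at l ?w" "x \<in> perp_at l ?w" using True unfolding perp_at_def by auto
    hence "?m \<in> perp_at l ?w" using mid_in_line[OF is_line_perp_at[OF l fl(1)]] by blast
    thus ?thesis using True unfolding perp_at_def by simp
  next
    case False
    let ?r = "perp_at l ?w" and ?n = "perp_at l ?x"
    let ?y = "psym ?m ?w" and ?z = "psym ?m ?x"
    have r: "is_line ?r" "w \<in> ?r" "?w \<in> ?r" "is_line ?n" "x \<in> ?n" "?x \<in> ?n"
      using is_line_perp_at l fl unfolding perp_at_def by auto
    have disj: "?r \<inter> ?n = {}" using perp_at_disjoint False by blast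
    have "?m \<notin> ?r"
    proof
      assume "?m \<in> ?r"
      hence "psym ?m w \<in> ?r" using line_psym[OF r(1)] r(2) by blast
      thus False using disj r by auto
    qed
    hence "psym ?m ` ?r \<inter> ?r = {}" using psym_line_disjoint[OF r(1)] by blast
    moreover have "x \<in> psym ?m ` ?r" using r(2) psym_mid(1)[of w x] by (metis imageI)
    ultimately have rn: "psym ?m ` ?r = ?n"
      using playfair[OF r(1), of "psym ?m ` ?r" x ?n] is_line_psym[OF r(1)] r disj by auto
    have "?y \<in> ?n" using rn r by blast
    hence fy: "foot l ?y = ?x" unfolding perp_at_def by simp
    obtain u where "u \<in> ?r" "?x = psym ?m u" using rn r(6) by blast
    hence "?z \<in> ?r" by simp
    hence fz: "foot l ?z = ?w" unfolding perp_at_def by simp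
    have "seg_cong ?x ?y ?w ?z" using psym_isometry[of ?m ?x ?y]
      by (metis cong_left cong_right cong_sym psym_psym)
    hence "seg_cong ?w ?y ?x ?z" using equal_heights[OF l fl(2,1) fy fz] by blast
    hence mw: "seg_cong ?m ?w ?m ?x" using cong_halve by blast
    have "per ?m (mid ?w ?x) ?w" unfolding per_def using mw by simp
    hence "per ?w (mid ?w ?x) ?m" by (rule per_sym)
    moreover have "?w \<noteq> mid ?w ?x" using False by (metis psym_mid(1) psym_self)
    ultimately show ?thesis using foot_unique[OF l mid_in_line[OF l fl] fl(1)] by metis
  qed
qed

text \<open>
  The segment from \<open>h\<close> to its foot is perpendicular to \<open>l\<close>, like \<open>perp_at l c\<close>, so these lines coincide or
  do not meet.
\<close>

lemma foot_not_opp: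
  assumes l: "is_line l" "c \<in> l" shows "\<not> opp (perp_at l c) h (foot l h)"
proof
  let ?n = "perp_at l c" and ?g = "foot l h"
  assume "opp ?n h ?g"
  then obtain t where t: "t \<in> ?n" "bet h t ?g" "h \<notin> ?n" "?g \<notin> ?n" unfolding opp_def
    by blast
  have hg: "h \<noteq> ?g" using t bet_identity by metis
  have g: "?g \<in> l" using foot_in l by blast
  have "h \<in> perp_at l ?g" "?g \<in> perp_at l ?g" using g l unfolding perp_at_def by auto
  hence "t \<in> perp_at l ?g" using line_bet[OF is_line_perp_at[OF l(1) g], of h ?g t] t hg by blast
  hence "?g = c" using t unfolding perp_at_def by simp
  thus False using t l by simp
qed

text \<open>
  Feet remain on their sides of the perpendicular at \<open>c\<close>, so the order on \<open>l\<close> is that of the original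
  points; this takes care of all signs in the final construction.
\<close>

lemma foot_bet_through:
  assumes l: "is_line l" "c \<in> l" and b: "bet h c k" and n: "foot l h \<noteq> c" "foot l k \<noteq> c"
  shows "bet (foot l h) c (foot l k)"
proof -
  let ?n = "perp_at l c" and ?g = "foot l h" and ?m = "foot l k"
  have nl: "is_line ?n" "c \<in> ?n" using is_line_perp_at l by auto
  have g: "?g \<in> l" "?m \<in> l" using foot_in l by auto
  have nn: "h \<notin> ?n" "k \<notin> ?n" "?g \<notin> ?n" "?m \<notin> ?n" using n g l
    unfolding perp_at_def by auto
  have "opp ?n h k" using nn nl b unfolding opp_def by blast
  hence "opp ?n ?g k" using plane_separation[OF nl(1), of h k ?g] nn foot_not_opp[OF l] by blast
  hence "opp ?n ?g ?m" using plane_separation[OF nl(1), of ?g k ?m] nn foot_not_opp[OF l] opp_sym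
    by blast
  then obtain t where t: "t \<in> ?n" "bet ?g t ?m" unfolding opp_def by blast
  have "?g \<noteq> ?m" using t nn bet_identity by metis
  hence "t \<in> l" using line_bet[OF l(1) g] t by blast
  hence "t = c" using t l unfolding perp_at_def by simp
  thus ?thesis using t by simp
qed

section \<open>Scaling about a point\<close>

text \<open>
  For lines \<open>a\<close>, \<open>b\<close> through a point, the arguments of \<open>mid\<close> are the images of \<open>v\<close> under a rotation and its
  inverse, so this is multiplication with the cosine of twice the angle between \<open>a\<close> and \<open>b\<close>.
\<close>

definition scale :: "'a set \<Rightarrow> 'a set \<Rightarrow> 'a \<Rightarrow> 'a" where
  "scale a b v = mid (mirror a (mirror b v)) (mirror b (mirror a v))"

text \<open>
  The product of three reflections in concurrent lines is an involution, that is, equal to the product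
  in reverse order.
\<close>

lemma mirror_triple:
  assumes "is_line a" "c \<in> a" "is_line b" "c \<in> b" "is_line m" "c \<in> m"
  shows "mirror a (mirror b (mirror m v)) = mirror m (mirror b (mirror a v))"
  using three_reflections[OF assms, of "mirror m (mirror b (mirror a v))"] assms by simp

text \<open>
  Conjugation with a reflection turns the rotation into its inverse, and the midpoint is symmetric in both.
\<close>

lemma scale_mirror:
  assumes "is_line a" "c \<in> a" "is_line b" "c \<in> b" "is_line m" "c \<in> m"
  shows "scale a b (mirror m v) = mirror m (scale a b v)"
  unfolding scale_def isom_mid[OF isom_mirror[OF assms(5)]]
  using mirror_triple[OF assms, of v] mirror_triple[OF assms(3,4,1,2,5,6), of v] mid_commute by simp

lemma scale_in_line:
  assumes "is_line a" "c \<in> a" "is_line b" "c \<in> b" "is_line m" "c \<in> m" "v \<in> m"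
  shows "scale a b v \<in> m"
  using scale_mirror[OF assms(1-6), of v] assms(5,7) mirror_fixed_iff mirror_on_line by metis

text \<open>
  Points at the same distance from the centre are exchanged by a reflection.
\<close>

lemma scale_cong:
  assumes "is_line a" "c \<in> a" "is_line b" "c \<in> b" "seg_cong c u c v"
  shows "seg_cong c (scale a b u) c (scale a b v)"
proof (cases "u = c")
  case True thus ?thesis using assms by (metis cong_eq_iff cong_refl)
next
  case False
  then obtain m where m: "is_line m" "c \<in> m" "mirror m u = v" using ex_mirror_swap assms(5) by blast
  have "scale a b v = mirror m (scale a b u)" using scale_mirror[OF assms(1-4) m(1,2), of u] m(3) by simp
  thus ?thesis using isomD[OF isom_mirror[OF m(1)], of c "scale a b u"] m cong_sym by simp
qed

text \<open>
  With \<open>f\<close> the rotation and \<open>?g\<close> the foot of \<open>v\<close>: since \<open>?g\<close> is the midpoint of \<open>v\<close> and its mirror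
  image, \<open>foot_mid\<close> expresses \<open>foot m (f ?g)\<close> by the feet of \<open>f v\<close> and \<open>f\<inverse> v\<close>, which gives
  \<open>foot m (scale a b v)\<close>. On the other hand it is \<open>scale a b ?g\<close>, which is on \<open>m\<close> already.
\<close>

lemma foot_scale:
  assumes a: "is_line a" "c \<in> a" and b: "is_line b" "c \<in> b" and m: "is_line m" "c \<in> m"
  shows "foot m (scale a b v) = scale a b (foot m v)"
proof -
  let ?f = "\<lambda>x. mirror a (mirror b x)" and ?f' = "\<lambda>x. mirror b (mirror a x)"
  let ?g = "foot m v"
  have g: "?g \<in> m" using foot_in m by blast
  have "?f' ?g = ?f' (mirror m ?g)" using m g by simp
  also have "\<dots> = mirror m (?f ?g)" using mirror_triple[OF b a m] .
  finally have e1: "foot m (?f' ?g) = foot m (?f ?g)" using m by simp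
  have "?g = mid v (mirror m v)" unfolding mirror_def by simp
  hence "?f ?g = mid (?f v) (?f (mirror m v))"
    using isom_mid[OF isom_comp[OF isom_mirror[OF a(1)] isom_mirror[OF b(1)]]] by simp
  also have "?f (mirror m v) = mirror m (?f' v)" using mirror_triple[OF a b m] .
  finally have e2: "foot m (?f ?g) = mid (foot m (?f v)) (foot m (?f' v))"
    using foot_mid[OF m(1)] m by simp
  have "scale a b ?g = foot m (scale a b ?g)" using scale_in_line[OF a b m g] m by simp
  also have "\<dots> = mid (foot m (?f ?g)) (foot m (?f' ?g))" unfolding scale_def
    using foot_mid[OF m(1)] .
  also have "\<dots> = foot m (?f ?g)" using e1 by simp
  also have "\<dots> = foot m (scale a b v)" unfolding e2 scale_def using foot_mid[OF m(1)] by simp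
  finally show ?thesis by simp
qed

text \<open>
  Draw a right triangle with hypotenuse of the length of \<open>cp\<close> and leg \<open>cr\<close>: the perpendicular at \<open>r\<close> meets
  the circle about \<open>c\<close> through \<open>p\<close> at a point \<open>x\<close>, and the rotation taking \<open>p\<close> to \<open>x\<close> does it.
\<close>

lemma ex_scale:
  assumes "bet c r p" "r \<noteq> c"
  shows "\<exists>a b. is_line a \<and> c \<in> a \<and> is_line b \<and> c \<in> b \<and> scale a b p = r"
proof -
  have pc: "p \<noteq> c" using assms bet_identity by blast
  let ?b = "line c p"
  have b: "is_line ?b" "c \<in> ?b" "p \<in> ?b" using pc by auto
  have rb: "r \<in> ?b" using assms line_bet[OF b] pc by blast
  show ?thesis
  proof (cases "r = p")
    case True
    hence "scale ?b ?b p = r" unfolding scale_def using b by simp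
    thus ?thesis using b by blast
  next
    case False
    let ?k = "perp_at ?b r"
    have k: "is_line ?k" "r \<in> ?k" using is_line_perp_at b rb by auto
    obtain u where u: "u \<noteq> r" "u \<in> ?k" using line_ex_other[OF k(1), of r] by metis
    have "bet r u r \<or> bet u r r \<or> bet r r u" by simp
    then obtain x where x: "bet r u x \<or> bet u x r \<or> bet x r u" "seg_cong c x c p"
      using line_circle[of r u r c p] u assms False by metis
    have "x \<in> ?k" using line_col[OF k u(2), of x] u x(1) unfolding col_def by metis
    hence fx: "foot ?b x = r" unfolding perp_at_def by simp
    obtain a where a: "is_line a" "c \<in> a" "mirror a p = x"
      using ex_mirror_swap[of c p x] x pc cong_sym by blast
    have "scale a ?b p = mid x (mirror ?b x)" unfolding scale_def using a b by simp
    also have "\<dots> = r" unfolding mirror_def fx by simp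
    finally show ?thesis using a b by blast
  qed
qed

section \<open>Equal rectangles and equal triangles\<close>

lemma rectangle_foot:
  assumes "rectangle a b c d"
  shows "foot (line b a) d = a" "foot (line b c) d = c"
proof -
  have "per b a d" "per b c d" using assms per_sym unfolding rectangle_iff by auto
  thus "foot (line b a) d = a" "foot (line b c) d = c"
    using assms foot_unique[of "line b a" a b d] foot_unique[of "line b c" c b d]
    unfolding rectangle_iff by auto
qed

text \<open>
  The right angle at \<open>k\<close> is supplied by Lambert's quadrilateral.
\<close>

lemma rectangle_from_feet:
  assumes "per m c e" "m \<noteq> c" "e \<noteq> c" "foot (line c m) k = m" "foot (line c e) k = e"
  shows "rectangle c m k e"
proof -
  have l: "is_line (line c m)" "is_line (line c e)" using assms by auto
  have p: "per c m k" "per c e k" using foot_per[OF l(1), of c k] foot_per[OF l(2), of c k] assms by auto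
  have fe: "foot (line c m) e = c" using foot_unique[OF l(1), of c m e] assms by simp
  have fm: "foot (line c e) m = c" using foot_unique[OF l(2), of c e m] assms per_sym by simp
  have "k \<noteq> e" "k \<noteq> m" using fe fm assms by metis+
  moreover have "per m k e"
    using lambert[of k e c m] calculation assms p per_sym by metis
  ultimately show ?thesis using assms p per_sym unfolding rectangle_iff by metis
qed

text \<open>
  Let \<open>h\<close> be the vertex opposite to \<open>c\<close> in the rectangle with sides \<open>cg\<close> and \<open>cn\<close>. The projections of
  \<open>scale a b h\<close> are \<open>scale a b g\<close> and \<open>scale a b n\<close>, and it lies on the line \<open>ch\<close>. So this point, or its
  reflection in \<open>c\<close>, is the vertex that the definition requires to be opposite to \<open>h\<close>.
\<close>

lemma equal_rectangles_by_scale: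
  assumes a: "is_line a" "c \<in> a" and b: "is_line b" "c \<in> b"
    and g: "right_angle g c n" and nz: "scale a b g \<noteq> c" "scale a b n \<noteq> c"
    and r: "rectangle r1 r2 r3 r4" "seg_cong r1 r2 c g" "seg_cong r2 r3 c (scale a b n)"
    and s: "rectangle s1 s2 s3 s4" "seg_cong s1 s2 c (scale a b g)" "seg_cong s2 s3 c n"
  shows "equal_rectangles (r1, r2, r3, r4) (s1, s2, s3, s4)"
proof -
  let ?k = "scale a b"
  have gn: "g \<noteq> c" "n \<noteq> c" "per g c n" using g unfolding right_angle_iff by auto
  obtain h where h: "rectangle g c n h" using ex_fourth_vertex[of g c n] gn by metis
  let ?lg = "line c g" and ?ln = "line c n"
  have lg: "is_line ?lg" "c \<in> ?lg" "g \<in> ?lg" and ln: "is_line ?ln" "c \<in> ?ln" "n \<in> ?ln"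
    using gn by auto
  have fh: "foot ?lg h = g" "foot ?ln h = n" using rectangle_foot[OF h] by auto
  have fk: "foot ?lg (?k h) = ?k g" "foot ?ln (?k h) = ?k n" using foot_scale[OF a b] lg ln fh by auto
  have hc: "h \<noteq> c" using fh gn lg by (metis foot_self)
  have kh: "?k h \<noteq> c" using fk nz lg by (metis foot_self)
  have "?k h \<in> line c h" using scale_in_line[OF a b, of "line c h" h] hc by simp
  hence col: "col c h (?k h)" unfolding line_def by simp
  \<comment> \<open>The sign: \<open>scale\<close> may map \<open>h\<close> to either ray, so the image is reflected in \<open>c\<close> if necessary.\<close>
  obtain k m e where kme: "foot ?lg k = m" "foot ?ln k = e" "bet h c k" "seg_cong c m c (?k g)" "seg_cong c e c (?k n)"
  proof (cases "bet h c (?k h)")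
    case True
    show ?thesis by (rule that[of "?k h" "?k g" "?k n"]) (use True fk in auto)
  next
    case False
    hence "out c (?k h) h" using col kh hc bet_sym unfolding col_def out_def by blast
    hence "bet h c (psym c (?k h))" using out_bet[of c "?k h" h "psym c (?k h)"] by simp
    thus ?thesis using that[of "psym c (?k h)" "psym c (?k g)" "psym c (?k n)"] fk foot_psym lg ln
      by simp
  qed
  have me: "m \<noteq> c" "e \<noteq> c" using kme nz cong_eq_iff by metis+
  have ml: "m \<in> ?lg" "e \<in> ?ln" using kme foot_in lg ln by blast+
  have bm: "bet g c m" using foot_bet_through[OF lg(1,2) kme(3)] fh kme gn me by simp
  have be: "bet n c e" using foot_bet_through[OF ln(1,2) kme(3)] fh kme gn me by simp
  have lgm: "line c m = ?lg" "line c e = ?ln"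
    using line_eq[OF lg(1,2) ml(1)] line_eq[OF ln(1,2) ml(2)] me by metis+
  have p1: "per m c n" using per_col[of g c n m] gn bm bet_col by metis
  have p2: "per m c e" using per_right_col[of m c n e] p1 gn be bet_col by metis
  have p3: "per g c e" using per_right_col[of g c n e] gn be bet_col by metis
  have rk: "rectangle c m k e" using rectangle_from_feet[OF p2 me] lgm kme by simp
  obtain f where f: "rectangle e c g f" using ex_fourth_vertex[of e c g] me gn p3 per_sym by metis
  obtain l where l: "rectangle m c n l" using ex_fourth_vertex[of m c n] me gn p1 by metis
  have F: "rectangle f e c g" using f rectangle_rotate by blast
  have L: "rectangle c m l n" using l rectangle_reverse by blast
  have H: "rectangle n c g h" using h rectangle_reverse rectangle_rotate by blast
  have "seg_cong f e c g" using rectangle_opposite_sides(1)[OF F] .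
  hence "congruent_rectangles (r1, r2, r3, r4) (f, e, c, g)"
    unfolding congruent_rectangles_def using r F kme
    by (auto) (meson cong_left cong_right cong_sym cong_trans)+
  moreover have "seg_cong m l n c" using rectangle_opposite_sides(2)[OF L] .
  hence "congruent_rectangles (s1, s2, s3, s4) (c, m, l, n)"
    unfolding congruent_rectangles_def using s L kme
    by (auto) (meson cong_left cong_right cong_sym cong_trans)+
  moreover have "sbet n c e" "sbet g c m" "sbet h c k"
    using be bm kme gn me hc rk unfolding sbet_def rectangle_iff by (auto simp: foot_self)
  ultimately show ?thesis unfolding equal_rectangles_def using H rk by blast
qed

text \<open>
  The configuration of the definition read from the other end, with \<open>H\<close> and \<open>K\<close> exchanged.
\<close>

lemma equal_rectangles_sym:
  assumes "equal_rectangles (r1, r2, r3, r4) (s1, s2, s3, s4)"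
  shows "equal_rectangles (s1, s2, s3, s4) (r1, r2, r3, r4)"
proof -
  obtain a b e f g h k l m where
    c: "congruent_rectangles (r1, r2, r3, r4) (f, e, b, g)" "congruent_rectangles (s1, s2, s3, s4) (b, m, l, a)"
    and bt: "sbet a b e" "sbet g b m" "sbet h b k" and re: "rectangle a b g h" "rectangle b m k e"
    using assms unfolding equal_rectangles_def by blast
  have F: "rectangle f e b g" and L: "rectangle b m l a"
    using c unfolding congruent_rectangles_def by auto
  have L': "rectangle l a b m" using L rectangle_rotate by blast
  have F': "rectangle b g f e" using F rectangle_rotate by blast
  have "congruent_rectangles (s1, s2, s3, s4) (l, a, b, m)"
    using c(2) L' rectangle_opposite_sides[OF L] unfolding congruent_rectangles_def
    by (auto) (meson cong_left cong_right cong_sym cong_trans)+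
  moreover have "congruent_rectangles (r1, r2, r3, r4) (b, g, f, e)"
    using c(1) F' rectangle_opposite_sides[OF F] unfolding congruent_rectangles_def
    by (auto) (meson cong_left cong_right cong_sym cong_trans)+
  moreover have "sbet e b a" "sbet m b g" "sbet k b h" using bt bet_sym unfolding sbet_def by auto
  moreover have "rectangle e b m k" "rectangle b g h a" using re rectangle_rotate by blast+
  ultimately show ?thesis unfolding equal_rectangles_def by blast
qed

lemma equal_rectangles_cong:
  assumes "equal_rectangles (r1, r2, r3, r4) (s1, s2, s3, s4)"
    and "congruent_rectangles (q1, q2, q3, q4) (r1, r2, r3, r4)"
  shows "equal_rectangles (q1, q2, q3, q4) (s1, s2, s3, s4)"
proof -
  have "congruent_rectangles (q1, q2, q3, q4) x" if "congruent_rectangles (r1, r2, r3, r4) x" for x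
    using assms(2) that cong_trans unfolding congruent_rectangles_def by (cases x) auto
  thus ?thesis using assms(1) unfolding equal_rectangles_def by metis
qed

lemma rectangle_congruent_reverse:
  assumes "rectangle a b c d"
  shows "congruent_rectangles (a, b, c, d) (b, a, d, c)" "congruent_rectangles (b, a, d, c) (a, b, c, d)"
  using assms rectangle_reverse[OF assms] rectangle_opposite_sides(2)[OF assms]
  unfolding congruent_rectangles_def by (auto) (meson cong_left cong_right cong_sym)+

text \<open>
  Scaling with the identity rotation, written as the square of a reflection.
\<close>

lemma equal_rectangles_refl:
  assumes "rectangle a b c d" shows "equal_rectangles (a, b, c, d) (a, b, c, d)"
proof -
  let ?l = "line b a"
  have n: "right_angle a b c" "a \<noteq> b" using assms unfolding rectangle_def right_angle_iff by auto
  have l: "is_line ?l" "b \<in> ?l" using n by auto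
  have s: "scale ?l ?l v = v" for v unfolding scale_def using l by simp
  show ?thesis using equal_rectangles_by_scale[OF l l n(1), of a b c d a b c d] s n assms
    unfolding rectangle_iff by auto
qed

text \<open>
  The reflection in \<open>t\<close> takes \<open>c\<close> to \<open>p = scale u v a\<close> and the height point \<open>d\<close> to \<open>scale u v d'\<close>, so the same
  scaling relates both pairs of dimensions. The point \<open>m\<close> transports the height \<open>bd'\<close> to the
  perpendicular of \<open>ab\<close>, as \<open>equal_rectangles_by_scale\<close> uses two perpendicular axes.
\<close>

lemma equal_rectangles_at_vertex_le:
  assumes nc: "\<not> col a b c" and le: "le b c b a"
    and r: "rectangle a b d k" "col d k c" and s: "rectangle c b d' k'" "col d' k' a"
  shows "equal_rectangles (a, b, d, k) (c, b, d', k')"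
proof -
  have ne: "a \<noteq> b" "c \<noteq> b" "d \<noteq> b" "d' \<noteq> b" using nc r s
    unfolding rectangle_iff by auto
  obtain p where p: "bet b p a" "seg_cong b c b p" using le unfolding le_def by blast
  have pb: "p \<noteq> b" using p ne cong_eq_iff by metis
  obtain u v where u: "is_line u" "b \<in> u" and v: "is_line v" "b \<in> v" and up: "scale u v a = p"
    using ex_scale[OF p(1) pb] by blast
  obtain t where t: "is_line t" "b \<in> t" "mirror t c = p" using ex_mirror_swap[OF p(2) ne(2)] by blast
  let ?n = "line b d" and ?n' = "line b d'"
  have n: "is_line ?n" "is_line ?n'" using ne by auto
  have "per b d c" using r(1) per_right_col[of b d k c] col_perm(1)[OF r(2)] unfolding rectangle_iff
    by metis
  hence fd: "foot ?n c = d" using foot_unique[OF n(1), of d b c] ne by auto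
  have "per b d' a" using s(1) per_right_col[of b d' k' a] col_perm(1)[OF s(2)]
    unfolding rectangle_iff by metis
  hence fd': "foot ?n' a = d'" using foot_unique[OF n(2), of d' b a] ne by auto
  have la: "is_line (line b a)" "b \<in> line b a" "a \<in> line b a" and lc: "is_line (line b c)" "b \<in> line b c" "c \<in> line b c" using ne by auto
  have na: "perp_at (line b a) b = ?n"
    using perp_at_eqI[OF la(1,2,3), of d] ne r unfolding rectangle_iff by metis
  have nc': "perp_at (line b c) b = ?n'"
    using perp_at_eqI[OF lc(1,2,3), of d'] ne s unfolding rectangle_iff by metis
  have it: "isom (mirror t)" using isom_mirror t by blast
  have tb: "mirror t b = b" and tp: "mirror t p = c" using t by auto
  have "line b a = line b p" using line_eq[OF la(1,2), of p] p pb line_bet[OF la] ne by metis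
  hence t1: "mirror t x \<in> line b c" if "x \<in> line b a" for x
    using isom_col[OF it, of b p x] that tb tp unfolding line_def by simp
  have t2: "mirror t x \<in> ?n'" if "x \<in> ?n" for x
  proof -
    have "foot (line b a) x = b" using that na unfolding perp_at_def by blast
    hence "foot (line b c) (mirror t x) = b" using isom_foot[OF it la(1) lc(1) t1, of x] tb by simp
    thus ?thesis using nc' unfolding perp_at_def by blast
  qed
  have "mirror t d = foot ?n' p" using isom_foot[OF it n t2, of c] fd t by simp
  also have "\<dots> = scale u v d'" using foot_scale[OF u v n(2), of a] up fd' by simp
  finally have td: "mirror t d = scale u v d'" .
  have bd: "seg_cong b d b (scale u v d')" using isomD[OF it, of b d] tb td cong_sym by simp
  obtain m where m: "bet d b m" "seg_cong b m b d'" using segment_construction by blast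
  have mb: "m \<noteq> b" using m ne cong_eq_iff by metis
  have pm: "per a b m" using per_right_col[of a b d m] r m ne bet_col unfolding rectangle_iff by metis
  have km: "seg_cong b (scale u v m) b (scale u v d')" using scale_cong[OF u v m(2)] .
  have "scale u v m \<noteq> b" using km bd ne cong_eq_iff by metis
  moreover have "right_angle a b m" using ne mb pm unfolding right_angle_iff by auto
  moreover have "seg_cong b d b (scale u v m)" using bd km cong_sym cong_trans by blast
  moreover have "seg_cong c b b (scale u v a)" using p up cong_left by simp
  moreover have "seg_cong b d' b m" using m cong_sym by blast
  ultimately show ?thesis
    using equal_rectangles_by_scale[OF u v, of a m a b d k c b d' k'] r s up pb by simp
qed

lemma equal_rectangles_at_vertex:
  assumes "\<not> col a b c" "rectangle a b d k" "col d k c" "rectangle c b d' k'" "col d' k' a"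
  shows "equal_rectangles (a, b, d, k) (c, b, d', k')"
proof (cases "le b c b a")
  case True thus ?thesis using equal_rectangles_at_vertex_le assms by blast
next
  case False
  hence "le b a b c" using le_total by blast
  moreover have "\<not> col c b a" using assms col_perm by blast
  ultimately show ?thesis using equal_rectangles_at_vertex_le[of c b a d' k' d k] assms equal_rectangles_sym by blast
qed

text \<open>
  Project \<open>c\<close> to the perpendicular of \<open>ab\<close> at \<open>b\<close> and complete the rectangle; the perpendicular at the
  projection contains both \<open>c\<close> and the fourth vertex.
\<close>

lemma ex_first_circumscribed_rectangle:
  assumes "\<not> col a b c" shows "\<exists>d k. rectangle a b d k \<and> col d k c"
proof -
  let ?l = "line a b"
  let ?n = "perp_at ?l b"
  let ?d = "foot ?n c"
  have ab: "a \<noteq> b" using assms by auto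
  have l: "is_line ?l" "b \<in> ?l" "a \<in> ?l" using ab by auto
  have cl: "c \<notin> ?l" using assms unfolding line_def by simp
  have n: "is_line ?n" "b \<in> ?n" using is_line_perp_at l by auto
  have d: "?d \<in> ?n" using foot_in n by blast
  hence "foot ?l ?d = b" unfolding perp_at_def by simp
  hence p1: "per a b ?d" using foot_per[OF l(1,3), of ?d] by simp
  have p2: "per b ?d c" using foot_per[OF n, of c] .
  have db: "?d \<noteq> b"
  proof
    assume *: "?d = b"
    obtain x where x: "x \<noteq> b" "x \<in> ?n" using line_ex_other[OF n(1), of b] by metis
    have pa: "per x b a" using foot_per[OF l(1,3), of x] x(2) per_sym unfolding perp_at_def by auto
    have "per x b c" using foot_per[OF n(1) x(2), of c] * by simp
    hence "a \<in> perp_at ?n b" "c \<in> perp_at ?n b" "b \<in> perp_at ?n b"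
      using foot_unique[OF n x(2,1)] n pa unfolding perp_at_def by auto
    hence "perp_at ?n b = ?l" using line_eq[of "perp_at ?n b" a b] is_line_perp_at[OF n] ab by blast
    thus False using cl \<open>c \<in> perp_at ?n b\<close> by simp
  qed
  obtain k where k: "rectangle a b ?d k" using ex_fourth_vertex[OF ab] db p1 by metis
  have lk: "perp_at (line b ?d) ?d = line ?d k" using rectangle_lines(2)[OF k] .
  have "?n = line b ?d" using line_eq[OF n d] db by metis
  hence "c \<in> perp_at (line b ?d) ?d" unfolding perp_at_def by simp
  hence "col ?d k c" using lk unfolding line_def by simp
  thus ?thesis using k by blast
qed

end

theorem lemma6p3:
  fixes A B C :: "'a::euclidean_plane"
  assumes "triangle (A, B, C)"
  shows "equal_triangles (A, B, C) (B, C, A) \<and>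
         equal_triangles (A, B, C) (C, A, B) \<and>
         equal_triangles (A, B, C) (A, C, B) \<and>
         equal_triangles (A, B, C) (B, A, C) \<and>
         equal_triangles (A, B, C) (C, B, A)"
proof -
  have nc: "\<not> col A B C" using assms unfolding triangle_def by simp
  hence nc': "\<not> col C B A" "\<not> col C A B" "\<not> col B A C" "\<not> col B C A" "\<not> col A C B" using col_perm by blast+
  obtain D K where r: "rectangle A B D K" "col D K C" using ex_first_circumscribed_rectangle[OF nc]
    by blast
  obtain E L where s: "rectangle C B E L" "col E L A"
    using ex_first_circumscribed_rectangle[OF nc'(1)] by blast
  obtain F M where t: "rectangle C A F M" "col F M B"
    using ex_first_circumscribed_rectangle[OF nc'(2)] by blast
  have rev: "rectangle B A K D" "col K D C" "rectangle B C L E" "col L E A" "rectangle A C M F" "col M F B"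
    using r s t rectangle_reverse col_perm(1) by blast+
  have eq: "equal_triangles (A, B, C) (x, y, z)"
    if "\<not> col x y z" "equal_rectangles (A, B, D, K) (x, y, u, v)" "rectangle x y u v" "col u v z" for x y z u v
    unfolding equal_triangles_def triangle_def first_circumscribed_rectangle_def
    using that nc r by (intro conjI exI[of _ "(A, B, D, K)"] exI[of _ "(x, y, u, v)"]) auto
  have 1: "equal_rectangles (A, B, D, K) (C, B, E, L)" using equal_rectangles_at_vertex[OF nc r s] .
  have "equal_rectangles (B, A, K, D) (C, A, F, M)"
    using equal_rectangles_at_vertex[OF nc'(3) rev(1,2) t] .
  hence 2: "equal_rectangles (A, B, D, K) (C, A, F, M)"
    using equal_rectangles_cong rectangle_congruent_reverse(1)[OF r(1)] by blast
  have turn: "equal_rectangles (A, B, D, K) (y, x, v, u)"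
    if "equal_rectangles (A, B, D, K) (x, y, u, v)" "rectangle x y u v" for x y u v
    using equal_rectangles_sym[OF equal_rectangles_cong[OF equal_rectangles_sym[OF that(1)] rectangle_congruent_reverse(2)[OF that(2)]]] .
  show ?thesis
    using eq[OF nc'(4) turn[OF 1 s(1)] rev(3,4)] eq[OF nc'(2) 2 t] eq[OF nc'(5) turn[OF 2 t(1)] rev(5,6)]
      eq[OF nc'(3) turn[OF equal_rectangles_refl[OF r(1)] r(1)] rev(1,2)] eq[OF nc'(1) 1 s] by simp
qed

end
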